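(* Let $(M^m,g)$ be a Kähler manifold of complex dimension $m\ge2$. If the orthogonal Ricci curvature of $M$ is nonnegative then its scalar curvature $S$ is nonnegative. In fact, at every point $y\in M$, $$S(y)\ge\frac{2m(m+1)}{m-1}\ \min_{Z\in\mathbb S^{2m-1}_y\subset T'_yM}Ric^{\perp}(Z,\overline Z),$$ where $\mathbb S^{2m-1}_y=\{Z\in T'_yM:\ |Z|=1\}$.
   Context: $C$ is the almost complex structure, $T'M$ the bundle of $(1,0)$ vectors, $\langle\cdot,\cdot\rangle$ the complex bilinear extension of the Riemannian metric, $|Z|^2=\langle Z,\overline Z\rangle$. The curvature tensor $R$ (extended complex-multilinearly) has the sign convention that $R(X,Y,Y,X)$ is the sectional curvature for orthonormal real $X,Y$. For unit $Z\in T'_yM$, $Ric^\perp(Z,\overline Z)=Ric(Z,\overline Z)-R(Z,\overline Z,Z,\overline Z)=\sum_{j=2}^mR(Z,\overline Z,E_j,\overline E_j)$, where $\{Z,E_2,\dots,E_m\}$ is a unitary basis of $T'_yM$; equivalently, for $Z=\frac1{\sqrt2}(X-\sqrt{-1}C(X))$ with $X$ a real unit vector, it equals $Ric(X,X)-R(X,C(X),C(X),X)$. $S$ is the Riemannian scalar curvature (trace of the Ricci tensor over a real orthonormal basis of $T_yM$). *)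

theory Defs
  imports "HOL-Analysis.Analysis"
begin

section \<open>Smooth and holomorphic maps\<close>

primrec Ck_on :: "nat \<Rightarrow> ('e::euclidean_space \<Rightarrow> real) \<Rightarrow> 'e set \<Rightarrow> bool" where
  "Ck_on 0 f S \<longleftrightarrow> continuous_on S f"
| "Ck_on (Suc k) f S \<longleftrightarrow> (\<forall>x\<in>S. f differentiable (at x)) \<and>
     (\<forall>v. Ck_on k (\<lambda>x. frechet_derivative f (at x) v) S)"

definition smooth_on :: "('e::euclidean_space \<Rightarrow> real) \<Rightarrow> 'e set \<Rightarrow> bool" where
  "smooth_on f S \<longleftrightarrow> (\<forall>k. Ck_on k f S)"

text \<open>Holomorphy on open subsets of complex m-space: real differentiability with a
  complex linear derivative.\<close>

definition holomorphic_map_on :: "(complex^'m::finite \<Rightarrow> complex^'m) \<Rightarrow> (complex^'m) set \<Rightarrow> bool" where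
  "holomorphic_map_on f S \<longleftrightarrow>
     (\<forall>x\<in>S. \<exists>D. (f has_derivative D) (at x) \<and> (\<forall>v. D (\<i> *s v) = \<i> *s D v))"

section \<open>Complex manifolds and their tangent vectors\<close>

type_synonym ('a, 'm) chart = "'a set \<times> ('a \<Rightarrow> complex^'m)"

definition is_chart :: "'a topology \<Rightarrow> ('a, 'm::finite) chart \<Rightarrow> bool" where
  "is_chart M c \<longleftrightarrow> openin M (fst c) \<and> open (snd c ` fst c) \<and>
     homeomorphic_map (subtopology M (fst c)) (top_of_set (snd c ` fst c)) (snd c)"

definition transition :: "('a, 'm) chart \<Rightarrow> ('a, 'm) chart \<Rightarrow> complex^'m \<Rightarrow> complex^'m" where
  "transition c d = snd d \<circ> inv_into (fst c) (snd c)"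

text \<open>\<open>A\<close> is a holomorphic atlas (not necessarily maximal).\<close>

definition complex_manifold :: "'a topology \<Rightarrow> ('a, 'm::finite) chart set \<Rightarrow> bool" where
  "complex_manifold M A \<longleftrightarrow>
     Hausdorff_space M \<and> second_countable M \<and>
     (\<forall>c\<in>A. is_chart M c) \<and> (\<Union>c\<in>A. fst c) = topspace M \<and>
     (\<forall>c\<in>A. \<forall>d\<in>A. holomorphic_map_on (transition c d) (snd c ` (fst c \<inter> fst d)))"

text \<open>A real tangent vector at \<open>y\<close> is the family of its coordinate vectors in all charts around
  \<open>y\<close>, which transform by the derivatives of the transition maps. At other arguments the family
  is set to 0, so that equality of tangent vectors is equality of functions.\<close>

type_synonym ('a, 'm) tvec = "('a, 'm) chart \<Rightarrow> complex^'m"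

definition tangent_space :: "('a, 'm::finite) chart set \<Rightarrow> 'a \<Rightarrow> ('a, 'm) tvec set" where
  "tangent_space A y = {X.
     (\<forall>c\<in>A. \<forall>d\<in>A. y \<in> fst c \<longrightarrow> y \<in> fst d \<longrightarrow>
        X d = frechet_derivative (transition c d) (at (snd c y)) (X c)) \<and>
     (\<forall>c. \<not> (c \<in> A \<and> y \<in> fst c) \<longrightarrow> X c = 0)}"

text \<open>The tangent vector at \<open>y\<close> whose coordinate vector in the chart \<open>c\<close> is \<open>u\<close>.\<close>

definition tvec_of :: "('a, 'm::finite) chart set \<Rightarrow> ('a, 'm) chart \<Rightarrow> 'a \<Rightarrow> complex^'m \<Rightarrow> ('a, 'm) tvec" where
  "tvec_of A c y u = (\<lambda>d. if d \<in> A \<and> y \<in> fst d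
     then frechet_derivative (transition c d) (at (snd c y)) u else 0)"

text \<open>The almost complex structure.\<close>

definition acs :: "('a, 'm::finite) tvec \<Rightarrow> ('a, 'm) tvec" where
  "acs X = (\<lambda>c. \<i> *s X c)"

section \<open>Kaehler metrics\<close>

text \<open>A metric \<open>g\<close> assigns to \<open>y\<close> a bilinear form on the real tangent space at \<open>y\<close>.\<close>

type_synonym ('a, 'm) metric = "'a \<Rightarrow> ('a, 'm) tvec \<Rightarrow> ('a, 'm) tvec \<Rightarrow> real"

definition local_metric ::
  "('a, 'm::finite) chart set \<Rightarrow> ('a, 'm) metric \<Rightarrow> ('a, 'm) chart
     \<Rightarrow> complex^'m \<Rightarrow> complex^'m \<Rightarrow> complex^'m \<Rightarrow> real" where
  "local_metric A g c x u v =
     (let y = inv_into (fst c) (snd c) x in g y (tvec_of A c y u) (tvec_of A c y v))"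

definition hermitian_metric :: "('a, 'm::finite) chart set \<Rightarrow> ('a, 'm) metric \<Rightarrow> bool" where
  "hermitian_metric A g \<longleftrightarrow> (\<forall>c\<in>A. let H = local_metric A g c in
     (\<forall>u v. smooth_on (\<lambda>x. H x u v) (snd c ` fst c)) \<and>
     (\<forall>x\<in>snd c ` fst c. bilinear (H x) \<and>
        (\<forall>u v. H x u v = H x v u) \<and>
        (\<forall>u. u \<noteq> 0 \<longrightarrow> H x u u > 0) \<and>
        (\<forall>u v. H x (\<i> *s u) (\<i> *s v) = H x u v)))"

text \<open>The Kaehler form in a chart is \<open>\<omega>(u,v) = H(\<i>u,v)\<close>; on constant vector fields
  \<open>d\<omega>(u,v,w)\<close> is the cyclic sum of the derivatives of \<open>\<omega>(v,w)\<close> along \<open>u\<close>.\<close>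

definition kahler_form_closed :: "('a, 'm::finite) chart set \<Rightarrow> ('a, 'm) metric \<Rightarrow> bool" where
  "kahler_form_closed A g \<longleftrightarrow>
     (\<forall>c\<in>A. let \<omega> = (\<lambda>v w x. local_metric A g c x (\<i> *s v) w) in
        \<forall>x\<in>snd c ` fst c. \<forall>u v w.
          frechet_derivative (\<omega> v w) (at x) u +
          frechet_derivative (\<omega> w u) (at x) v +
          frechet_derivative (\<omega> u v) (at x) w = 0)"

definition kahler_manifold ::
  "'a topology \<Rightarrow> ('a, 'm::finite) chart set \<Rightarrow> ('a, 'm) metric \<Rightarrow> bool" where
  "kahler_manifold M A g \<longleftrightarrow>
     complex_manifold M A \<and> hermitian_metric A g \<and> kahler_form_closed A g"

section \<open>Curvature\<close>

text \<open>The Levi-Civita covariant derivative of the constant field \<open>v\<close> along \<open>u\<close> at \<open>x\<close>, for a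
  metric \<open>H\<close> on an open subset of complex m-space, given by the Koszul formula.\<close>

definition christoffel ::
  "(complex^'m \<Rightarrow> complex^'m \<Rightarrow> complex^'m \<Rightarrow> real)
     \<Rightarrow> complex^'m \<Rightarrow> complex^'m \<Rightarrow> complex^'m \<Rightarrow> complex^'m::finite" where
  "christoffel H x u v = (THE w. \<forall>z. 2 * H x w z =
     frechet_derivative (\<lambda>p. H p v z) (at x) u +
     frechet_derivative (\<lambda>p. H p u z) (at x) v -
     frechet_derivative (\<lambda>p. H p u v) (at x) z)"

text \<open>\<open>R(u,v)w = \<nabla>_u \<nabla>_v w - \<nabla>_v \<nabla>_u w\<close> for constant fields.\<close>

definition local_curv ::
  "(complex^'m \<Rightarrow> complex^'m \<Rightarrow> complex^'m \<Rightarrow> real)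
     \<Rightarrow> complex^'m \<Rightarrow> complex^'m \<Rightarrow> complex^'m \<Rightarrow> complex^'m \<Rightarrow> complex^'m::finite" where
  "local_curv H x u v w =
     frechet_derivative (\<lambda>p. christoffel H p v w) (at x) u + christoffel H x u (christoffel H x v w)
   - (frechet_derivative (\<lambda>p. christoffel H p u w) (at x) v + christoffel H x v (christoffel H x u w))"

definition chart_at :: "('a, 'm) chart set \<Rightarrow> 'a \<Rightarrow> ('a, 'm) chart" where
  "chart_at A y = (SOME c. c \<in> A \<and> y \<in> fst c)"

text \<open>\<open>R(X,Y,Z,W) = \<langle>R(X,Y)Z, W\<rangle>\<close>, so that \<open>R(X,Y,Y,X)\<close> is the sectional curvature for orthonormal
  \<open>X\<close>, \<open>Y\<close>. It is computed in a chosen chart; being a tensor, it does not depend on the choice.\<close>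

definition curv ::
  "('a, 'm::finite) chart set \<Rightarrow> ('a, 'm) metric \<Rightarrow> 'a
     \<Rightarrow> ('a, 'm) tvec \<Rightarrow> ('a, 'm) tvec \<Rightarrow> ('a, 'm) tvec \<Rightarrow> ('a, 'm) tvec \<Rightarrow> real" where
  "curv A g y X Y Z W = (let c = chart_at A y; H = local_metric A g c; x = snd c y in
     H x (local_curv H x (X c) (Y c) (Z c)) (W c))"

text \<open>The real tangent space has real dimension \<open>2 * CARD('m)\<close>, so an orthonormal set with that many
  elements is an orthonormal basis.\<close>

definition orthonormal_basis ::
  "('a, 'm::finite) chart set \<Rightarrow> ('a, 'm) metric \<Rightarrow> 'a \<Rightarrow> ('a, 'm) tvec set \<Rightarrow> bool" where
  "orthonormal_basis A g y B \<longleftrightarrow> B \<subseteq> tangent_space A y \<and> card B = 2 * CARD('m) \<and>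
     (\<forall>e\<in>B. \<forall>f\<in>B. g y e f = (if e = f then 1 else 0))"

definition some_onb ::
  "('a, 'm::finite) chart set \<Rightarrow> ('a, 'm) metric \<Rightarrow> 'a \<Rightarrow> ('a, 'm) tvec set" where
  "some_onb A g y = (SOME B. orthonormal_basis A g y B)"

text \<open>As traces, the following two do not depend on the chosen orthonormal basis.\<close>

definition ricci ::
  "('a, 'm::finite) chart set \<Rightarrow> ('a, 'm) metric \<Rightarrow> 'a \<Rightarrow> ('a, 'm) tvec \<Rightarrow> ('a, 'm) tvec \<Rightarrow> real" where
  "ricci A g y X Y = (\<Sum>e\<in>some_onb A g y. curv A g y e X Y e)"

definition scalar_curvature ::
  "('a, 'm::finite) chart set \<Rightarrow> ('a, 'm) metric \<Rightarrow> 'a \<Rightarrow> real" where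
  "scalar_curvature A g y = (\<Sum>e\<in>some_onb A g y. ricci A g y e e)"

section \<open>The complexified tangent space and orthogonal Ricci curvature\<close>

text \<open>The pair \<open>(X, Y)\<close> represents \<open>X + \<surd>-1 Y\<close> in the complexification of the real tangent space.
  This formal imaginary unit is different from the almost complex structure.\<close>

type_synonym ('a, 'm) ctvec = "('a, 'm) tvec \<times> ('a, 'm) tvec"

definition ctvec_cnj :: "('a, 'm::finite) ctvec \<Rightarrow> ('a, 'm) ctvec" where
  "ctvec_cnj Z = (fst Z, \<lambda>c. - snd Z c)"

text \<open>Vectors of type (1,0): \<open>C Z = \<surd>-1 Z\<close>, where \<open>C\<close> is extended complex linearly and
  \<open>\<surd>-1 (X + \<surd>-1 Y) = -Y + \<surd>-1 X\<close>.\<close>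

definition T10_space :: "('a, 'm::finite) chart set \<Rightarrow> 'a \<Rightarrow> ('a, 'm) ctvec set" where
  "T10_space A y = {Z \<in> tangent_space A y \<times> tangent_space A y.
     (acs (fst Z), acs (snd Z)) = (\<lambda>c. - snd Z c, fst Z)}"

text \<open>Complex multilinear extensions of real multilinear forms: expand every argument
  \<open>X + \<surd>-1 Y\<close>.\<close>

definition cext2 ::
  "(('a, 'm) tvec \<Rightarrow> ('a, 'm) tvec \<Rightarrow> real) \<Rightarrow> ('a, 'm) ctvec \<Rightarrow> ('a, 'm) ctvec \<Rightarrow> complex" where
  "cext2 B Z1 Z2 =
     (\<Sum>(X, a) \<in> {(fst Z1, 1), (snd Z1, \<i>)}. \<Sum>(Y, b) \<in> {(fst Z2, 1), (snd Z2, \<i>)}.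
        a * b * complex_of_real (B X Y))"

definition cext4 ::
  "(('a, 'm) tvec \<Rightarrow> ('a, 'm) tvec \<Rightarrow> ('a, 'm) tvec \<Rightarrow> ('a, 'm) tvec \<Rightarrow> real)
     \<Rightarrow> ('a, 'm) ctvec \<Rightarrow> ('a, 'm) ctvec \<Rightarrow> ('a, 'm) ctvec \<Rightarrow> ('a, 'm) ctvec \<Rightarrow> complex" where
  "cext4 T Z1 Z2 Z3 Z4 =
     (\<Sum>(X, a) \<in> {(fst Z1, 1), (snd Z1, \<i>)}. \<Sum>(Y, b) \<in> {(fst Z2, 1), (snd Z2, \<i>)}.
      \<Sum>(V, p) \<in> {(fst Z3, 1), (snd Z3, \<i>)}. \<Sum>(W, q) \<in> {(fst Z4, 1), (snd Z4, \<i>)}.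
        a * b * p * q * complex_of_real (T X Y V W))"

text \<open>The sphere of \<open>Z\<close> of type (1,0) with \<open>\<langle>Z, cnj Z\<rangle> = 1\<close>.\<close>

definition T10_sphere ::
  "('a, 'm::finite) chart set \<Rightarrow> ('a, 'm) metric \<Rightarrow> 'a \<Rightarrow> ('a, 'm) ctvec set" where
  "T10_sphere A g y = {Z \<in> T10_space A y. cext2 (g y) Z (ctvec_cnj Z) = 1}"

text \<open>\<open>Ric(Z, cnj Z) - R(Z, cnj Z, Z, cnj Z)\<close>; this number is real, because \<open>Ric\<close> is symmetric
  and \<open>R\<close> has the usual symmetries, so \<open>Re\<close> only changes the type.\<close>

definition ric_perp ::
  "('a, 'm::finite) chart set \<Rightarrow> ('a, 'm) metric \<Rightarrow> 'a \<Rightarrow> ('a, 'm) ctvec \<Rightarrow> real" where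
  "ric_perp A g y Z = Re (cext2 (ricci A g y) Z (ctvec_cnj Z)
     - cext4 (curv A g y) Z (ctvec_cnj Z) Z (ctvec_cnj Z))"

end

theory Submission
  imports Defs
begin

text \<open>At a fixed point, put \<open>F(X) = R(X,CX,CX,X)\<close>. For an orthonormal basis \<open>B\<close> of the real tangent
  space (of dimension \<open>n = 2m\<close>) consider the \<open>2^n\<close> vectors \<open>\<Sum>e\<in>B. \<plusminus>e\<close>, all of squared
  length \<open>n\<close>. Averaging over the signs replaces the integral over the unit sphere: the average of
  \<open>Ric\<close> is \<open>S\<close>, and the average of \<open>F\<close> plus \<open>2 * (\<Sum>e\<in>B. F e)\<close> is \<open>4 * S\<close> by the
  symmetries of a Kaehler curvature tensor. If \<open>Ric(X,X)\<bar>X\<bar>^2 - F(X) \<ge> \<mu>\<bar>X\<bar>^4\<close> for all \<open>X\<close>, averaging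
  these inequalities over the sign vectors and adding twice those for \<open>B\<close> gives \<open>n(n+2)\<mu> \<le> (n-2)S\<close>.

  The curvature symmetries are derived in a chart: closedness of the Kaehler form makes the
  Christoffel symbols complex linear, and symmetry of the second
  derivatives of the metric yields skew-symmetry in the last two arguments.\<close>

section \<open>Inner products on a Euclidean space\<close>

text \<open>The form \<open>h\<close> is unrelated to the standard inner product of the type: the
  metric at a point of a chart is an arbitrary inner product on coordinate space. The type supplies
  only dimension and topology.\<close>

locale euclidean_form =
  fixes h :: "'v::euclidean_space \<Rightarrow> 'v \<Rightarrow> real"
  assumes bil: "bilinear h" and sym: "h u v = h v u" and pos: "u \<noteq> 0 \<Longrightarrow> h u u > 0"
begin

lemmas h_simps = bilinear_ladd[OF bil] bilinear_radd[OF bil] bilinear_lsub[OF bil]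
  bilinear_rsub[OF bil] bilinear_lmul[OF bil] bilinear_rmul[OF bil] bilinear_lneg[OF bil]
  bilinear_rneg[OF bil] bilinear_lzero[OF bil] bilinear_rzero[OF bil]

lemma linear_l: "linear (\<lambda>x. h x y)" and linear_r: "linear (h x)"
  using bil by (auto simp: bilinear_def)

lemma h_sum_l: "h (\<Sum>i\<in>I. f i) y = (\<Sum>i\<in>I. h (f i) y)"
  by (rule linear_sum[OF linear_l])

lemma h_sum_r: "h x (\<Sum>i\<in>I. f i) = (\<Sum>i\<in>I. h x (f i))"
  by (rule linear_sum[OF linear_r])

lemma eq_0_iff: "h u u = 0 \<longleftrightarrow> u = 0"
  using pos[of u] by (cases "u = 0") (auto simp: h_simps)

lemma eqI: "(\<And>z. h u z = h v z) \<Longrightarrow> u = v"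
  using eq_0_iff[of "u - v"] by (simp add: h_simps)

definition orthonormal :: "'v set \<Rightarrow> bool" where
  "orthonormal B \<longleftrightarrow> (\<forall>e\<in>B. \<forall>f\<in>B. h e f = (if e = f then 1 else 0))"

lemma orthonormal_coeff:
  assumes "orthonormal B" "finite T" "T \<subseteq> B" "f \<in> B"
  shows "h (\<Sum>e\<in>T. c e *\<^sub>R e) f = (if f \<in> T then c f else 0)"
proof -
  have "h (\<Sum>e\<in>T. c e *\<^sub>R e) f = (\<Sum>e\<in>T. if e = f then c e else 0)"
    unfolding h_sum_l h_simps using assms by (intro sum.cong) (auto simp: orthonormal_def)
  then show ?thesis using assms by (simp add: sum.delta)
qed

lemma orthonormal_independent:
  assumes "orthonormal B" shows "independent B"
  unfolding independent_explicit_module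
proof (intro allI impI)
  fix T u v assume T: "finite T" "T \<subseteq> B" "(\<Sum>v\<in>T. u v *\<^sub>R v) = 0" "v \<in> T"
  then have "h (\<Sum>v\<in>T. u v *\<^sub>R v) v = u v"
    using orthonormal_coeff[OF assms, of T v u] by auto
  with T show "u v = 0" by (simp add: h_simps)
qed

lemma orthonormal_finite: "orthonormal B \<Longrightarrow> finite B"
  using orthonormal_independent independent_bound by blast

lemma orthonormal_expansion:
  assumes "orthonormal B" "card B = DIM('v)"
  shows "x = (\<Sum>e\<in>B. h x e *\<^sub>R e)"
proof -
  have fin: "finite B" by (rule orthonormal_finite[OF assms(1)])
  have span: "span B = UNIV"
    using card_ge_dim_independent[of B UNIV] orthonormal_independent[OF assms(1)] assms(2) by auto
  \<comment> \<open>The remainder is orthogonal to \<open>B\<close>, hence to \<open>span B\<close>,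
    which is the whole space, hence to itself.\<close>
  define w where "w = x - (\<Sum>e\<in>B. h x e *\<^sub>R e)"
  have "h w e = 0" if "e \<in> B" for e
    using orthonormal_coeff[OF assms(1) fin, of e "h x"] that by (simp add: w_def h_simps)
  then have "h w v = 0" if "v \<in> span B" for v
    using linear_eq_0_on_span[OF linear_r] that by blast
  then have "h w w = 0" by (simp add: span)
  then show ?thesis by (simp add: eq_0_iff w_def)
qed

text \<open>Each induction step is one Gram-Schmidt step, applied to a vector outside the
  span.\<close>

lemma orthonormal_exists: "k \<le> DIM('v) \<Longrightarrow> \<exists>B. orthonormal B \<and> card B = k"
proof (induction k)
  case 0
  show ?case by (intro exI[of _ "{}"]) (simp add: orthonormal_def)
next
  case (Suc k)
  then obtain B where B: "orthonormal B" "card B = k" by auto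
  have fin: "finite B" by (rule orthonormal_finite[OF B(1)])
  have "span B \<noteq> UNIV"
  proof
    assume "span B = UNIV"
    then have "DIM('v) \<le> card B" using dim_le_card[of UNIV B] fin by simp
    with B Suc.prems show False by simp
  qed
  then obtain v where v: "v \<notin> span B" by auto
  define w where "w = v - (\<Sum>e\<in>B. h v e *\<^sub>R e)"
  have perp: "h w e = 0" if "e \<in> B" for e
    using orthonormal_coeff[OF B(1) fin, of e "h v"] that by (simp add: w_def h_simps)
  have "w \<noteq> 0"
  proof
    assume "w = 0"
    then have "v = (\<Sum>e\<in>B. h v e *\<^sub>R e)" by (simp add: w_def)
    moreover have "(\<Sum>e\<in>B. h v e *\<^sub>R e) \<in> span B" by (intro span_sum span_scale span_base)
    ultimately show False using v by simp
  qed
  define u where "u = w /\<^sub>R sqrt (h w w)"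
  have "h w w > 0" by (rule pos) fact
  then have uu: "h u u = 1" by (simp add: u_def h_simps field_simps flip: power2_eq_square)
  have ue: "h u e = 0" if "e \<in> B" for e
    using perp[OF that] by (simp add: u_def h_simps)
  then have eu: "h e u = 0" if "e \<in> B" for e
    using that sym[of e u] by simp
  have "u \<notin> B" using ue uu by force
  then show ?case using B fin uu ue eu
    by (intro exI[of _ "insert u B"]) (auto simp: orthonormal_def)
qed

text \<open>The values of \<open>b\<close> on an orthonormal basis are the coefficients of the
  representing vector. This is what makes the definite description in \<open>christoffel\<close>
  meaningful.\<close>

lemma riesz:
  assumes "linear b" shows "\<exists>!w. \<forall>z. h w z = (b z :: real)"
proof -
  obtain B where B: "orthonormal B" "card B = DIM('v)" using orthonormal_exists by blast
  have "h (\<Sum>e\<in>B. b e *\<^sub>R e) z = b z" for z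
  proof -
    have "b z = b (\<Sum>e\<in>B. h z e *\<^sub>R e)" using orthonormal_expansion[OF B, of z] by simp
    also have "\<dots> = (\<Sum>e\<in>B. h z e * b e)" by (simp add: linear_sum[OF assms] linear_cmul[OF assms])
    finally show ?thesis by (simp add: h_sum_l h_simps sym[of z] mult.commute)
  qed
  then show ?thesis by (intro ex1I) (auto intro: eqI)
qed

text \<open>Expanding the first argument of \<open>T e e\<close> along \<open>C\<close>, or the
  second argument of \<open>T f f\<close> along \<open>B\<close>, leads to the same double
  sum.\<close>

lemma trace_basis_independent:
  assumes T: "bilinear T" and B: "orthonormal B" "card B = DIM('v)"
    and C: "orthonormal C" "card C = DIM('v)"
  shows "(\<Sum>e\<in>B. T e e) = (\<Sum>f\<in>C. T f f :: real)"
proof -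
  have l: "linear (\<lambda>x. T x y)" and r: "linear (T x)" for x y
    using T by (auto simp: bilinear_def)
  have "(\<Sum>e\<in>B. T e e) = (\<Sum>e\<in>B. \<Sum>f\<in>C. h e f * T f e)"
  proof (rule sum.cong[OF refl])
    fix e assume "e \<in> B"
    have "T e e = T (\<Sum>f\<in>C. h e f *\<^sub>R f) e"
      using orthonormal_expansion[OF C, of e] by simp
    then show "T e e = (\<Sum>f\<in>C. h e f * T f e)"
      by (simp add: linear_sum[OF l] linear_cmul[OF l])
  qed
  also have "\<dots> = (\<Sum>f\<in>C. \<Sum>e\<in>B. h f e * T f e)"
    by (subst sum.swap) (simp add: sym)
  also have "\<dots> = (\<Sum>f\<in>C. T f f)"
  proof (rule sum.cong[OF refl])
    fix f assume "f \<in> C"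
    have "T f f = T f (\<Sum>e\<in>B. h f e *\<^sub>R e)"
      using orthonormal_expansion[OF B, of f] by simp
    then show "(\<Sum>e\<in>B. h f e * T f e) = T f f"
      by (simp add: linear_sum[OF r] linear_cmul[OF r])
  qed
  finally show ?thesis .
qed

lemma compact_sphere:
  shows "compact {u. h u u = r}"
proof -
  have cont: "continuous_on UNIV (\<lambda>u. h u u)"
    by (rule bilinear_continuous_on_compose[OF continuous_on_id continuous_on_id bil])
  have "closed {u. h u u = r}"
    using continuous_closed_preimage_constant[OF cont, of r] by simp
  moreover have "bounded {u. h u u = r}"
  proof -
    \<comment> \<open>\<open>m\<close> is the minimum of the form on the standard unit sphere; by
      scaling, \<open>m * (norm u)\<^sup>2\<close> bounds \<open>h u u\<close> from below.\<close>
    obtain m where m: "m > 0" "\<And>u. norm u = 1 \<Longrightarrow> m \<le> h u u"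
    proof -
      obtain z where z: "z \<in> sphere 0 1" "\<forall>y\<in>sphere 0 1. h z z \<le> h y y"
        using continuous_attains_inf[of "sphere (0::'v) 1" "\<lambda>u. h u u"]
          continuous_on_subset[OF cont] by auto
      show ?thesis
      proof (rule that[of "h z z"])
        show "h z z > 0" using z by (intro pos) auto
      qed (use z in auto)
    qed
    have "norm u \<le> sqrt (r / m)" if "h u u = r" for u
    proof (cases "u = 0")
      case False
      have "m \<le> h (u /\<^sub>R norm u) (u /\<^sub>R norm u)" using False by (intro m) simp
      then have "m * (norm u)\<^sup>2 \<le> r" using False that
        by (simp add: h_simps field_simps power2_eq_square)
      then have "(norm u)\<^sup>2 \<le> r / m" using m by (simp add: field_simps)
      then show ?thesis by (rule real_le_rsqrt)
    next
      case True
      with that show ?thesis by (simp add: h_simps)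
    qed
    then show ?thesis by (auto simp: bounded_iff)
  qed
  ultimately show ?thesis by (simp add: compact_eq_bounded_closed)
qed

end

section \<open>Averaging over signs\<close>

text \<open>A choice of signs is encoded by the set of elements that receive -1, so that all choices
  over \<open>B\<close> are indexed by \<open>Pow B\<close>.\<close>

definition subset_sign :: "'a set \<Rightarrow> 'a \<Rightarrow> real" where
  "subset_sign T e = (if e \<in> T then -1 else 1)"

lemma subset_sign_square [simp]: "subset_sign T e * subset_sign T e = 1"
  by (simp add: subset_sign_def)

text \<open>Toggling the membership of \<open>k\<close> is an involution of \<open>Pow B\<close>, so
  the sum equals its own negative.\<close>

lemma sum_Pow_flip_eq_0:
  fixes f :: "'a set \<Rightarrow> real"
  assumes "k \<in> B" and "\<And>T. T \<subseteq> B \<Longrightarrow> f (sym_diff T {k}) = - f T"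
  shows "(\<Sum>T\<in>Pow B. f T) = 0"
proof -
  have "(\<Sum>T\<in>Pow B. f T) = (\<Sum>T\<in>Pow B. f (sym_diff T {k}))"
    using assms(1)
    by (intro sum.reindex_bij_witness[of _ "\<lambda>T. sym_diff T {k}" "\<lambda>T. sym_diff T {k}"])
      (auto intro!: arg_cong[of _ _ f])
  also have "\<dots> = - (\<Sum>T\<in>Pow B. f T)" using assms(2) by (simp add: sum_negf)
  finally show ?thesis by simp
qed

lemma subset_sign_flip:
  "subset_sign (sym_diff T {k}) e = (if e = k then - subset_sign T e else subset_sign T e)"
  by (auto simp: subset_sign_def)

lemma sum_subset_sign2:
  assumes "finite B" "a \<in> B" "b \<in> B"
  shows "(\<Sum>T\<in>Pow B. subset_sign T a * subset_sign T b) = 2 ^ card B * of_bool (a = b)"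
proof (cases "a = b")
  case True
  with assms show ?thesis by (simp add: card_Pow)
next
  case False
  have "(\<Sum>T\<in>Pow B. subset_sign T a * subset_sign T b) = 0"
  proof (rule sum_Pow_flip_eq_0[OF assms(2)])
    show "subset_sign (sym_diff T {a}) a * subset_sign (sym_diff T {a}) b
      = - (subset_sign T a * subset_sign T b)" for T
      unfolding subset_sign_flip using False by simp
  qed
  with False show ?thesis by simp
qed

text \<open>The product of four signs is constantly 1 when the indices match in pairs and averages
  to 0 otherwise. If all four agree, the three pairings each count, and the last term removes the
  excess 2.\<close>

lemma sum_subset_sign4:
  assumes "finite B" "a \<in> B" "b \<in> B" "c \<in> B" "d \<in> B"
  shows "(\<Sum>T\<in>Pow B. subset_sign T a * subset_sign T b * subset_sign T c * subset_sign T d) =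
    2 ^ card B * (of_bool (a = b \<and> c = d) + of_bool (a = c \<and> b = d) + of_bool (a = d \<and> b = c)
      - 2 * of_bool (a = b \<and> b = c \<and> c = d))"
proof -
  \<comment> \<open>Flipping the sign at an index value that occurs an odd number of times negates
    the product.\<close>
  have *: "(\<Sum>T\<in>Pow B. subset_sign T a * subset_sign T b * subset_sign T c * subset_sign T d) = 0"
    if "k \<in> B" "odd (of_bool (a = k) + of_bool (b = k) + of_bool (c = k) + of_bool (d = k) :: nat)" for k
  proof (rule sum_Pow_flip_eq_0[OF that(1)])
    show "subset_sign (sym_diff T {k}) a * subset_sign (sym_diff T {k}) b
        * subset_sign (sym_diff T {k}) c * subset_sign (sym_diff T {k}) d =
      - (subset_sign T a * subset_sign T b * subset_sign T c * subset_sign T d)" for T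
      unfolding subset_sign_flip using that(2)
      by (cases "a = k"; cases "b = k"; cases "c = k"; cases "d = k") simp_all
  qed
  have s: "subset_sign T x * (subset_sign T x * y) = y" for T y and x :: 'a
    by (simp add: subset_sign_def)
  consider "a = b" "c = d" | "a = c" "b = d" | "a = d" "b = c"
    | "\<not> (a = b \<and> c = d)" "\<not> (a = c \<and> b = d)" "\<not> (a = d \<and> b = c)" by blast
  then show ?thesis
  proof cases
    case 4
    \<comment> \<open>Without a perfect pairing some index value occurs once or three times.\<close>
    then consider "a \<noteq> b" "a \<noteq> c" "a \<noteq> d" | "a = b" "c \<noteq> d" | "a = c" "b \<noteq> d" | "a = d" "b \<noteq> c"
      by blast
    then have "(\<Sum>T\<in>Pow B. subset_sign T a * subset_sign T b * subset_sign T c * subset_sign T d) = 0"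
    proof cases
      case 1 with assms show ?thesis by (intro *[of a]) auto
    next
      case 2
      with assms show ?thesis using *[of c] *[of d] by (cases "a = c") auto
    next
      case 3
      with assms show ?thesis using *[of b] *[of d] by (cases "a = b") auto
    next
      case 4
      with assms show ?thesis using *[of b] *[of c] by (cases "a = b") auto
    qed
    moreover have "\<not> (a = b \<and> b = c \<and> c = d)" using 4 by blast
    ultimately show ?thesis by (simp only: 4 of_bool_eq) simp
  next
    case 1
    have "subset_sign T a * subset_sign T b * subset_sign T c * subset_sign T d = 1" for T
      using 1 by (simp add: mult.assoc s)
    with 1 assms show ?thesis by (cases "a = c") (simp_all add: card_Pow)
  next
    case 2
    have "subset_sign T a * subset_sign T b * subset_sign T c * subset_sign T d = 1" for T
      using 2 by (simp add: mult_ac s)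
    with 2 assms show ?thesis by (cases "a = b") (simp_all add: card_Pow)
  next
    case 3
    have "subset_sign T a * subset_sign T b * subset_sign T c * subset_sign T d = 1" for T
      using 3 by (simp add: mult_ac s)
    with 3 assms show ?thesis by (cases "a = b") (simp_all add: card_Pow)
  qed
qed

definition signed_sum :: "'v::real_vector set \<Rightarrow> 'v set \<Rightarrow> 'v" where
  "signed_sum B T = (\<Sum>e\<in>B. subset_sign T e *\<^sub>R e)"

text \<open>After bilinear expansion the cross terms cancel in the sum over all signs, and only the
  trace is left.\<close>

lemma sum_signed_sum2:
  fixes Q :: "'v::real_vector \<Rightarrow> 'v \<Rightarrow> real"
  assumes "finite B" and lin: "\<And>y. linear (\<lambda>x. Q x y)" "\<And>x. linear (Q x)"
  shows "(\<Sum>T\<in>Pow B. Q (signed_sum B T) (signed_sum B T)) = 2 ^ card B * (\<Sum>a\<in>B. Q a a)"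
proof -
  have "(\<Sum>T\<in>Pow B. Q (signed_sum B T) (signed_sum B T)) =
    (\<Sum>T\<in>Pow B. \<Sum>a\<in>B. \<Sum>b\<in>B. subset_sign T a * subset_sign T b * Q a b)"
    unfolding signed_sum_def
    unfolding linear_sum[OF lin(1)] linear_cmul[OF lin(1)]
    unfolding linear_sum[OF lin(2)] linear_cmul[OF lin(2)]
    by (simp add: sum_distrib_left mult_ac)
  also have "\<dots> = (\<Sum>a\<in>B. \<Sum>b\<in>B. (\<Sum>T\<in>Pow B. subset_sign T a * subset_sign T b) * Q a b)"
    unfolding sum.swap[of _ _ "Pow B"] sum_distrib_right ..
  also have "\<dots> = (\<Sum>a\<in>B. \<Sum>b\<in>B. if a = b then 2 ^ card B * Q a b else 0)"
    by (intro sum.cong refl) (use assms in \<open>simp add: sum_subset_sign2\<close>)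
  also have "\<dots> = 2 ^ card B * (\<Sum>a\<in>B. Q a a)"
    using assms(1) by (simp add: sum_distrib_left sum.delta)
  finally show ?thesis .
qed

lemma sum_signed_sum4:
  fixes Q :: "'v::real_vector \<Rightarrow> 'v \<Rightarrow> 'v \<Rightarrow> 'v \<Rightarrow> real"
  assumes "finite B"
    and lin: "\<And>y z w. linear (\<lambda>x. Q x y z w)" "\<And>x z w. linear (\<lambda>y. Q x y z w)"
      "\<And>x y w. linear (\<lambda>z. Q x y z w)" "\<And>x y z. linear (\<lambda>w. Q x y z w)"
  shows "(\<Sum>T\<in>Pow B. Q (signed_sum B T) (signed_sum B T) (signed_sum B T) (signed_sum B T)) =
    2 ^ card B * ((\<Sum>a\<in>B. \<Sum>b\<in>B. Q a a b b + Q a b a b + Q a b b a) - 2 * (\<Sum>a\<in>B. Q a a a a))"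
proof -
  have "(\<Sum>T\<in>Pow B. Q (signed_sum B T) (signed_sum B T) (signed_sum B T) (signed_sum B T)) =
    (\<Sum>T\<in>Pow B. \<Sum>a\<in>B. \<Sum>b\<in>B. \<Sum>c\<in>B. \<Sum>d\<in>B.
      subset_sign T a * subset_sign T b * subset_sign T c * subset_sign T d * Q a b c d)"
    unfolding signed_sum_def
    unfolding linear_sum[OF lin(1)] linear_cmul[OF lin(1)]
    unfolding linear_sum[OF lin(2)] linear_cmul[OF lin(2)]
    unfolding linear_sum[OF lin(3)] linear_cmul[OF lin(3)]
    unfolding linear_sum[OF lin(4)] linear_cmul[OF lin(4)]
    by (simp add: sum_distrib_left mult_ac)
  also have "\<dots> = (\<Sum>a\<in>B. \<Sum>b\<in>B. \<Sum>c\<in>B. \<Sum>d\<in>B.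
      (\<Sum>T\<in>Pow B. subset_sign T a * subset_sign T b * subset_sign T c * subset_sign T d) * Q a b c d)"
    unfolding sum.swap[of _ _ "Pow B"] sum_distrib_right ..
  \<comment> \<open>Writing the pairings as nested conditionals lets the inner sums collapse one
    after another by the delta rule.\<close>
  also have "\<dots> = (\<Sum>a\<in>B. \<Sum>b\<in>B. \<Sum>c\<in>B. \<Sum>d\<in>B. 2 ^ card B *
      ((if a = b then if c = d then Q a b c d else 0 else 0)
      + (if a = c then if b = d then Q a b c d else 0 else 0)
      + (if b = c then if a = d then Q a b c d else 0 else 0)
      - 2 * (if a = b then if b = c then if c = d then Q a b c d else 0 else 0 else 0)))"
  proof (intro sum.cong refl)
    fix a b c d assume "a \<in> B" "b \<in> B" "c \<in> B" "d \<in> B"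
    then show "(\<Sum>T\<in>Pow B. subset_sign T a * subset_sign T b * subset_sign T c * subset_sign T d) * Q a b c d =
      2 ^ card B *
      ((if a = b then if c = d then Q a b c d else 0 else 0)
      + (if a = c then if b = d then Q a b c d else 0 else 0)
      + (if b = c then if a = d then Q a b c d else 0 else 0)
      - 2 * (if a = b then if b = c then if c = d then Q a b c d else 0 else 0 else 0))"
      unfolding sum_subset_sign4[OF assms(1) \<open>a \<in> B\<close> \<open>b \<in> B\<close> \<open>c \<in> B\<close> \<open>d \<in> B\<close>]
      by (cases "a = b"; cases "c = d"; cases "b = c"; cases "a = d"; cases "a = c"; cases "b = d") simp_all
  qed
  also have "\<dots> = 2 ^ card B * ((\<Sum>a\<in>B. \<Sum>b\<in>B. Q a a b b + Q a b a b + Q a b b a) - 2 * (\<Sum>a\<in>B. Q a a a a))"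
  proof -
    have [simp]: "(\<Sum>x\<in>B. if P then f x else 0) = (if P then \<Sum>x\<in>B. f x else 0)" for P and f :: "'v \<Rightarrow> real"
      by simp
    show ?thesis
      using assms(1) by (simp add: sum.distrib sum_subtractf flip: sum_distrib_left)
  qed
  finally show ?thesis .
qed

text \<open>Expanded along the standard basis, the diagonal is a polynomial in the coordinates of
  \<open>x\<close>.\<close>

lemma continuous_on_quadrilinear_diagonal:
  fixes Q :: "'v::euclidean_space \<Rightarrow> 'v \<Rightarrow> 'v \<Rightarrow> 'v \<Rightarrow> real"
  assumes lin: "\<And>y z w. linear (\<lambda>x. Q x y z w)" "\<And>x z w. linear (\<lambda>y. Q x y z w)"
      "\<And>x y w. linear (\<lambda>z. Q x y z w)" "\<And>x y z. linear (\<lambda>w. Q x y z w)"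
  shows "continuous_on S (\<lambda>x. Q x x x x)"
proof -
  have "Q x x x x = (\<Sum>a\<in>Basis. \<Sum>b\<in>Basis. \<Sum>c\<in>Basis. \<Sum>d\<in>Basis.
      (x \<bullet> a) * ((x \<bullet> b) * ((x \<bullet> c) * ((x \<bullet> d) * Q a b c d))))" for x
  proof -
    have "Q x x x x = Q (\<Sum>b\<in>Basis. (x \<bullet> b) *\<^sub>R b) (\<Sum>b\<in>Basis. (x \<bullet> b) *\<^sub>R b)
        (\<Sum>b\<in>Basis. (x \<bullet> b) *\<^sub>R b) (\<Sum>b\<in>Basis. (x \<bullet> b) *\<^sub>R b)"
      by (simp add: euclidean_representation)
    then show ?thesis
      unfolding linear_sum[OF lin(1)] linear_cmul[OF lin(1)]
      unfolding linear_sum[OF lin(2)] linear_cmul[OF lin(2)]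
      unfolding linear_sum[OF lin(3)] linear_cmul[OF lin(3)]
      unfolding linear_sum[OF lin(4)] linear_cmul[OF lin(4)]
      by (simp add: sum_distrib_left)
  qed
  then show ?thesis by (simp only:) (intro continuous_intros)
qed

section \<open>Kaehler curvature tensors\<close>

text \<open>The pointwise algebra, separated from all calculus. If \<open>K x y z w\<close> is
  \<open>h\<close> of R(x,y)z and w, then \<open>K_J34\<close> says that the operator R(x,y)
  commutes with \<open>J\<close>.\<close>

locale kahler_curvature = euclidean_form h for h :: "'v::euclidean_space \<Rightarrow> 'v \<Rightarrow> real" +
  fixes J :: "'v \<Rightarrow> 'v" and K :: "'v \<Rightarrow> 'v \<Rightarrow> 'v \<Rightarrow> 'v \<Rightarrow> real"
  assumes J_linear: "linear J" and J_J: "J (J x) = - x" and h_J: "h (J x) (J y) = h x y"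
    and K_linear: "linear (\<lambda>x. K x y z w)" "linear (\<lambda>y. K x y z w)"
      "linear (\<lambda>z. K x y z w)" "linear (\<lambda>w. K x y z w)"
    and K_swap12: "K x y z w = - K y x z w"
    and K_swap34: "K x y z w = - K x y w z"
    and K_bianchi: "K x y z w + K y z x w + K z x y w = 0"
    and K_J34: "K x y (J z) (J w) = K x y z w"
begin

text \<open>Adding the first two of the four cyclically shifted Bianchi identities and subtracting
  the other two leaves twice the difference of the two sides.\<close>

lemma K_pair: "K x y z w = K z w x y"
proof -
  have "K y z w x = - K y z x w" "K z w y x = - K z w x y" "K w x z y = - K w x y z"
    "K x y w z = - K x y z w" by (rule K_swap34)+
  moreover have "K w y z x = K y w x z" "K x z w y = K z x y w"
    using K_swap12[of w y z x] K_swap34[of y w z x] K_swap12[of x z w y] K_swap34[of z x w y] by simp_all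
  ultimately show ?thesis
    using K_bianchi[of x y z w] K_bianchi[of y z w x] K_bianchi[of z w x y] K_bianchi[of w x y z]
    by linarith
qed

lemma K_J12: "K (J x) (J y) z w = K x y z w"
  using K_pair[of "J x" "J y" z w] K_J34[of z w x y] K_pair[of z w x y] by linarith

lemmas K_neg = linear_neg[OF K_linear(1)] linear_neg[OF K_linear(2)] linear_neg[OF K_linear(3)]
  linear_neg[OF K_linear(4)]

lemma J_inj: "inj J"
proof (rule injI)
  fix x y assume "J x = J y"
  then have "J (J x) = J (J y)" by simp
  then show "x = y" by (simp add: J_J)
qed

lemma orthonormal_J: "orthonormal B \<Longrightarrow> orthonormal (J ` B)"
  unfolding orthonormal_def by (simp add: h_J inj_eq[OF J_inj])

definition ric :: "'v set \<Rightarrow> 'v \<Rightarrow> 'v \<Rightarrow> real" where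
  "ric B X Y = (\<Sum>e\<in>B. K e X Y e)"

lemma ric_linear: "linear (\<lambda>X. ric B X Y)" "linear (ric B X)"
  unfolding ric_def by (intro linear_compose_sum ballI K_linear)+

lemma ric_J:
  assumes "orthonormal B" "card B = DIM('v)"
  shows "ric B (J X) (J Y) = ric B X Y"
proof -
  have bil: "bilinear (\<lambda>e f. K e X Y f)"
    by (auto simp: bilinear_def K_linear)
  have "ric B (J X) (J Y) = (\<Sum>e\<in>B. K (J e) X Y (J e))"
    unfolding ric_def
  proof (rule sum.cong[OF refl])
    fix e
    have "K e (J X) (J Y) e = K (J e) (J (J X)) (J (J Y)) (J e)"
      by (simp add: K_J12 K_J34)
    then show "K e (J X) (J Y) e = K (J e) X Y (J e)" by (simp add: J_J K_neg)
  qed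
  also have "\<dots> = (\<Sum>e\<in>J ` B. K e X Y e)"
    by (subst sum.reindex) (auto intro: inj_on_subset[OF J_inj])
  also have "\<dots> = ric B X Y"
    unfolding ric_def using assms
    by (intro trace_basis_independent[OF bil] orthonormal_J)
      (auto simp: card_image inj_on_subset[OF J_inj])
  finally show ?thesis .
qed

lemma J_comp_linear: "linear (\<lambda>y. K x (J y) z w)" "linear (\<lambda>z. K x y (J z) w)"
  using linear_compose[OF J_linear K_linear(2)] linear_compose[OF J_linear K_linear(3)]
  by (auto simp: o_def)

text \<open>The hypothesis is homogeneous of degree four, because it is applied both to basis
  vectors and to sign vectors, whose squared length is the dimension.\<close>

lemma scalar_lower_bound:
  assumes B: "orthonormal B" "card B = DIM('v)"
    and \<mu>: "\<And>X. \<mu> * (h X X)\<^sup>2 \<le> ric B X X * h X X - K X (J X) (J X) X"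
  shows "real DIM('v) * (real DIM('v) + 2) * \<mu> \<le> (real DIM('v) - 2) * (\<Sum>e\<in>B. ric B e e)"
proof -
  define n where "n = real DIM('v)"
  define N :: real where "N = 2 ^ card B"
  define S where "S = (\<Sum>e\<in>B. ric B e e)"
  define F where "F = (\<Sum>e\<in>B. K e (J e) (J e) e)"
  have fin: "finite B" by (rule orthonormal_finite[OF B(1)])
  let ?X = "signed_sum B"
  have hX: "h (?X T) (?X T) = n" for T
  proof -
    have "h (?X T) (?X T) = (\<Sum>e\<in>B. subset_sign T e * h (?X T) e)"
      by (subst (2) signed_sum_def) (simp add: h_sum_r h_simps)
    also have "\<dots> = (\<Sum>e\<in>B. 1)"
      by (rule sum.cong[OF refl]) (use orthonormal_coeff[OF B(1) fin] in \<open>simp add: signed_sum_def\<close>)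
    finally show ?thesis using B(2) by (simp add: n_def)
  qed
  have S: "(\<Sum>a\<in>B. \<Sum>b\<in>B. K a b b a) = S"
    unfolding S_def ric_def by (rule sum.swap)
  \<comment> \<open>Summing over \<open>a\<close> first gives the Ricci form at \<open>J b\<close>,
    which equals that at \<open>b\<close>.\<close>
  have SJ: "(\<Sum>a\<in>B. \<Sum>b\<in>B. K a (J b) (J b) a) = S"
  proof -
    have "(\<Sum>a\<in>B. \<Sum>b\<in>B. K a (J b) (J b) a) = (\<Sum>b\<in>B. ric B (J b) (J b))"
      unfolding ric_def by (rule sum.swap)
    then show ?thesis by (simp add: ric_J[OF B] S_def)
  qed
  \<comment> \<open>The term pairing the first two and the last two slots is not a trace of Ricci
    type; the Bianchi identity splits it into two that are.\<close>
  have bianchi: "K a (J a) (J b) b = K a b b a + K a (J b) (J b) a" for a b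
  proof -
    have "K a (J a) (J b) b + K (J a) (J b) a b + K (J b) a (J a) b = 0" by (rule K_bianchi)
    moreover have "K (J a) (J b) a b = - K a b b a"
      by (metis K_J12 K_swap34)
    moreover have "K (J b) a (J a) b = - K a (J b) (J b) a"
      by (metis K_J34 K_swap12 K_swap34 J_J K_neg(3) minus_minus)
    ultimately show ?thesis by simp
  qed
  have abab: "K a (J b) (J a) b = K a (J b) (J b) a" for a b
    by (metis K_J34 K_swap34 J_J K_neg(3) minus_minus)
  have "(\<Sum>T\<in>Pow B. K (?X T) (J (?X T)) (J (?X T)) (?X T)) =
    N * ((\<Sum>a\<in>B. \<Sum>b\<in>B. K a (J a) (J b) b + K a (J b) (J a) b + K a (J b) (J b) a) - 2 * F)"
    unfolding N_def F_def
    by (rule sum_signed_sum4[OF fin, of "\<lambda>x y z w. K x (J y) (J z) w"]) (rule K_linear J_comp_linear)+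
  \<comment> \<open>Each summand becomes one unrotated term and three terms rotated by
    \<open>J\<close>. Each of these sums to \<open>S\<close>.\<close>
  moreover have "(\<Sum>a\<in>B. \<Sum>b\<in>B. K a (J a) (J b) b + K a (J b) (J a) b + K a (J b) (J b) a) = 4 * S"
  proof -
    have "K a (J a) (J b) b + K a (J b) (J a) b + K a (J b) (J b) a = K a b b a + 3 * K a (J b) (J b) a" for a b
      unfolding bianchi[of a b] abab[of a b] by simp
    then show ?thesis by (simp add: sum.distrib S SJ flip: sum_distrib_left)
  qed
  ultimately have KX: "(\<Sum>T\<in>Pow B. K (?X T) (J (?X T)) (J (?X T)) (?X T)) = N * (4 * S - 2 * F)"
    by simp
  have RX: "(\<Sum>T\<in>Pow B. ric B (?X T) (?X T)) = N * S"
    unfolding N_def S_def by (rule sum_signed_sum2[OF fin]) (rule ric_linear)+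
  have N: "real (card (Pow B)) = N" using fin by (simp add: card_Pow N_def)
  \<comment> \<open>First inequality: the hypothesis summed over all sign vectors. It still contains
    the diagonal sum \<open>F\<close>.\<close>
  have "(\<Sum>T\<in>Pow B. \<mu> * n\<^sup>2) \<le> (\<Sum>T\<in>Pow B. ric B (?X T) (?X T) * n - K (?X T) (J (?X T)) (J (?X T)) (?X T))"
  proof (rule sum_mono)
    show "\<mu> * n\<^sup>2 \<le> ric B (?X T) (?X T) * n - K (?X T) (J (?X T)) (J (?X T)) (?X T)" for T
      using \<mu>[of "?X T"] unfolding hX .
  qed
  then have "N * (\<mu> * n\<^sup>2) \<le> N * (S * n - (4 * S - 2 * F))"
    unfolding sum_subtractf sum_distrib_right[symmetric] KX RX by (simp add: N algebra_simps)
  then have 1: "\<mu> * n\<^sup>2 \<le> S * n - (4 * S - 2 * F)"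
    by (simp add: N_def)
  \<comment> \<open>Second inequality: the hypothesis summed over \<open>B\<close> itself, in which
    \<open>F\<close> has the opposite sign.\<close>
  have "(\<Sum>e\<in>B. \<mu>) \<le> (\<Sum>e\<in>B. ric B e e - K e (J e) (J e) e)"
  proof (rule sum_mono)
    fix e assume "e \<in> B"
    then have "h e e = 1" using B by (simp add: orthonormal_def)
    with \<mu>[of e] show "\<mu> \<le> ric B e e - K e (J e) (J e) e" by (simp only: power_one mult_1_right)
  qed
  then have 2: "n * \<mu> \<le> S - F" using B(2) by (simp add: sum_subtractf S_def F_def n_def)
  \<comment> \<open>With weight 2 on the second inequality \<open>F\<close> cancels, and the
    coefficient of \<open>S\<close> is n - 4 + 2.\<close>
  have "n * (n + 2) * \<mu> = \<mu> * n\<^sup>2 + 2 * (n * \<mu>)" by (simp add: power2_eq_square algebra_simps)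
  also have "\<dots> \<le> (n - 2) * S" using 1 2 by (simp add: algebra_simps)
  finally show ?thesis by (simp add: n_def S_def)
qed

text \<open>\<open>q x\<close> is the orthogonal Ricci curvature of Z = x - \<surd>-1 J x. Since Z
  has squared length \<open>2 * h x x\<close>, unit vectors Z correspond to
  \<open>h x x = 1 / 2\<close>. The minimum of \<open>q\<close> on this compact sphere serves as the
  constant in the previous bound.\<close>

lemma scalar_lower_bound_attained:
  assumes B: "orthonormal B" "card B = DIM('v)"
  defines "q \<equiv> \<lambda>x. 2 * ric B x x - 4 * K x (J x) (J x) x"
  obtains x where "h x x = 1 / 2" "\<And>z. h z z = 1 / 2 \<Longrightarrow> q x \<le> q z"
    "real DIM('v) * (real DIM('v) + 2) * q x \<le> (real DIM('v) - 2) * (\<Sum>e\<in>B. ric B e e)"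
proof -
  have "continuous_on {u. h u u = 1 / 2} (\<lambda>x. ric B x x)"
    by (rule bilinear_continuous_on_compose[OF continuous_on_id continuous_on_id])
      (simp add: bilinear_def ric_linear)
  moreover have "continuous_on {u. h u u = 1 / 2} (\<lambda>x. K x (J x) (J x) x)"
    by (rule continuous_on_quadrilinear_diagonal[where Q = "\<lambda>x y z w. K x (J y) (J z) w"])
      (rule K_linear J_comp_linear)+
  ultimately have "continuous_on {u. h u u = 1 / 2} q"
    unfolding q_def by (intro continuous_intros)
  moreover have "{u. h u u = 1 / 2} \<noteq> {}"
  proof -
    obtain e where "e \<in> B" using B(2) by fastforce
    then have "h e e = 1" using B(1) by (simp add: orthonormal_def)
    then have "h (sqrt (1 / 2) *\<^sub>R e) (sqrt (1 / 2) *\<^sub>R e) = 1 / 2"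
      by (simp add: h_simps flip: power2_eq_square)
    then show ?thesis by blast
  qed
  ultimately obtain x where x: "h x x = 1 / 2" "\<And>z. h z z = 1 / 2 \<Longrightarrow> q x \<le> q z"
    using continuous_attains_inf[OF compact_sphere] by blast
  have "q x * (h X X)\<^sup>2 \<le> ric B X X * h X X - K X (J X) (J X) X" for X
  proof (cases "X = 0")
    case True
    then show ?thesis by (simp add: h_simps linear_0[OF K_linear(1)])
  next
    case False
    define t where "t = h X X"
    have t: "t > 0" using pos[OF False] by (simp add: t_def)
    \<comment> \<open>Scaling by \<open>s\<close> puts \<open>X\<close> on the sphere;
      \<open>2 * s\<^sup>2\<close> is 1/t and \<open>4 * s^4\<close> is the square of 1/t, which
      matches the coefficients 2 and 4 in \<open>q\<close>.\<close>
    define s where "s = sqrt (1 / (2 * t))"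
    have s: "s * s = 1 / (2 * t)" using t by (simp add: s_def)
    have ss: "s * (s * a) = a / (2 * t)" for a
      using s by (simp add: mult.assoc[symmetric])
    have "h (s *\<^sub>R X) (s *\<^sub>R X) = 1 / 2"
      using t by (simp add: h_simps ss t_def)
    then have "q x \<le> q (s *\<^sub>R X)" by (rule x)
    also have "q (s *\<^sub>R X) = ric B X X / t - K X (J X) (J X) X / t\<^sup>2"
      using t unfolding q_def linear_cmul[OF ric_linear(1)] linear_cmul[OF ric_linear(2)]
        linear_cmul[OF J_linear] linear_cmul[OF K_linear(1)] linear_cmul[OF K_linear(2)]
        linear_cmul[OF K_linear(3)] linear_cmul[OF K_linear(4)]
      by (simp add: ss power2_eq_square)
    finally have "q x * t\<^sup>2 \<le> (ric B X X / t - K X (J X) (J X) X / t\<^sup>2) * t\<^sup>2"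
      using t by (intro mult_right_mono) auto
    also have "\<dots> = ric B X X * t - K X (J X) (J X) X"
      using t by (simp add: left_diff_distrib power2_eq_square)
    finally show ?thesis by (simp add: t_def)
  qed
  from scalar_lower_bound[OF B this] show ?thesis using that x by blast
qed

end

section \<open>Derivatives\<close>

lemma DERIV_along_line:
  fixes f :: "'e::real_normed_vector \<Rightarrow> real"
  assumes "f differentiable (at (a + r *\<^sub>R u))"
  shows "((\<lambda>r. f (a + r *\<^sub>R u)) has_real_derivative frechet_derivative f (at (a + r *\<^sub>R u)) u) (at r)"
proof -
  let ?D = "frechet_derivative f (at (a + r *\<^sub>R u))"
  have D: "(f has_derivative ?D) (at (a + r *\<^sub>R u))"
    using assms by (simp add: frechet_derivative_works)
  have "((\<lambda>r. a + r *\<^sub>R u) has_derivative (\<lambda>h. h *\<^sub>R u)) (at r)"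
    by (auto intro!: derivative_eq_intros)
  from has_derivative_compose[OF this, of f ?D]
  have "((\<lambda>r. f (a + r *\<^sub>R u)) has_derivative (\<lambda>h. ?D (h *\<^sub>R u))) (at r)" using D by simp
  moreover have "?D (h *\<^sub>R u) = ?D u * h" for h
    using linear_cmul[OF has_derivative_linear[OF D]] by simp
  ultimately show ?thesis by (simp add: has_field_derivative_def)
qed

text \<open>Two applications of the mean value theorem turn the second difference over a small
  parallelogram into t * t times the mixed derivative at a nearby point; continuity of that
  derivative does the rest.\<close>

lemma second_difference_approximation:
  fixes f :: "'e::euclidean_space \<Rightarrow> real"
  assumes S: "open S" "x \<in> S"
    and f: "\<And>p. p \<in> S \<Longrightarrow> f differentiable (at p)"
    and fu: "\<And>p. p \<in> S \<Longrightarrow> (\<lambda>q. frechet_derivative f (at q) u) differentiable (at p)"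
    and cont: "continuous_on S (\<lambda>p. frechet_derivative (\<lambda>q. frechet_derivative f (at q) u) (at p) v)"
    and e: "e > 0"
  shows "\<exists>d>0. \<forall>t. 0 < t \<longrightarrow> t < d \<longrightarrow>
    \<bar>f (x + t *\<^sub>R u + t *\<^sub>R v) - f (x + t *\<^sub>R u) - f (x + t *\<^sub>R v) + f x
      - t * t * frechet_derivative (\<lambda>q. frechet_derivative f (at q) u) (at x) v\<bar> < e * (t * t)"
proof -
  define fu' where "fu' = (\<lambda>q. frechet_derivative f (at q) u)"
  define g where "g = (\<lambda>p. frechet_derivative fu' (at p) v)"
  have "isCont g x"
    using cont S by (simp add: g_def fu'_def continuous_on_eq_continuous_at)
  then obtain d1 where d1: "d1 > 0" "\<And>p. dist p x < d1 \<Longrightarrow> \<bar>g p - g x\<bar> < e"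
    using e by (auto simp: continuous_at dist_real_def Lim_at)
      (metis dist_self e abs_zero diff_self dist_pos_lt)
  obtain d2 where d2: "d2 > 0" "ball x d2 \<subseteq> S"
    using S openE by blast
  \<comment> \<open>For t < \<open>d\<close> the parallelogram with sides t u and t v stays within
    \<open>min d1 d2\<close> of \<open>x\<close>. The summand 1 keeps the denominator
    positive.\<close>
  define d where "d = min d1 d2 / (norm u + norm v + 1)"
  have n: "norm u + norm v + 1 > 0" by (simp add: add_nonneg_pos)
  have near: "dist (x + a *\<^sub>R u + b *\<^sub>R v) x < min d1 d2"
    if "0 \<le> a" "a \<le> t" "0 \<le> b" "b \<le> t" "0 < t" "t < d" for a b t
  proof -
    have "dist (x + a *\<^sub>R u + b *\<^sub>R v) x = norm (a *\<^sub>R u + b *\<^sub>R v)"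
      by (simp add: dist_norm add.assoc)
    also have "\<dots> \<le> norm (a *\<^sub>R u) + norm (b *\<^sub>R v)" by (rule norm_triangle_ineq)
    also have "\<dots> = a * norm u + b * norm v" using that by simp
    also have "\<dots> \<le> t * norm u + t * norm v"
      using that by (intro add_mono mult_right_mono) auto
    also have "\<dots> \<le> t * (norm u + norm v + 1)" using that by (simp add: algebra_simps)
    also have "\<dots> < d * (norm u + norm v + 1)" using that n by (intro mult_strict_right_mono)
    also have "\<dots> = min d1 d2" using n by (simp add: d_def)
    finally show ?thesis .
  qed
  have inS: "x + a *\<^sub>R u + b *\<^sub>R v \<in> S"
    if "0 \<le> a" "a \<le> t" "0 \<le> b" "b \<le> t" "0 < t" "t < d" for a b t
    using near[OF that] d2 by (auto simp: subset_iff dist_commute)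
  have "\<bar>f (x + t *\<^sub>R u + t *\<^sub>R v) - f (x + t *\<^sub>R u) - f (x + t *\<^sub>R v) + f x - t * t * g x\<bar> < e * (t * t)"
    if t: "0 < t" "t < d" for t
  proof -
    \<comment> \<open>Mean value theorem in direction \<open>u\<close>, for the difference of
      \<open>f\<close> along two parallel segments.\<close>
    have "\<exists>z>0. z < t \<and> (f ((x + t *\<^sub>R v) + t *\<^sub>R u) - f (x + t *\<^sub>R u)) - (f ((x + t *\<^sub>R v) + 0 *\<^sub>R u) - f (x + 0 *\<^sub>R u))
      = (t - 0) * (fu' ((x + t *\<^sub>R v) + z *\<^sub>R u) - fu' (x + z *\<^sub>R u))"
    proof (rule MVT2[OF t(1)])
      fix r assume r: "0 \<le> r" "r \<le> t"
      have "(x + t *\<^sub>R v) + r *\<^sub>R u \<in> S" "x + r *\<^sub>R u \<in> S"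
        using inS[of r t t] inS[of r t 0] r t by (simp_all add: add_ac)
      then show "((\<lambda>r. f ((x + t *\<^sub>R v) + r *\<^sub>R u) - f (x + r *\<^sub>R u)) has_real_derivative
          fu' ((x + t *\<^sub>R v) + r *\<^sub>R u) - fu' (x + r *\<^sub>R u)) (at r)"
        unfolding fu'_def by (intro DERIV_diff DERIV_along_line f)
    qed
    then obtain z where z: "0 < z" "z < t"
      "f (x + t *\<^sub>R u + t *\<^sub>R v) - f (x + t *\<^sub>R u) - f (x + t *\<^sub>R v) + f x
       = t * (fu' (x + z *\<^sub>R u + t *\<^sub>R v) - fu' (x + z *\<^sub>R u))"
      by (auto simp: add_ac)
    \<comment> \<open>Mean value theorem in direction \<open>v\<close>, at the point
      \<open>z\<close> just found.\<close>
    have "\<exists>w>0. w < t \<and> fu' ((x + z *\<^sub>R u) + t *\<^sub>R v) - fu' ((x + z *\<^sub>R u) + 0 *\<^sub>R v)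
      = (t - 0) * g ((x + z *\<^sub>R u) + w *\<^sub>R v)"
    proof (rule MVT2[OF t(1)])
      fix r assume r: "0 \<le> r" "r \<le> t"
      have "x + z *\<^sub>R u + r *\<^sub>R v \<in> S" using inS[of z t r] r t z by simp
      then show "((\<lambda>r. fu' ((x + z *\<^sub>R u) + r *\<^sub>R v)) has_real_derivative
          g ((x + z *\<^sub>R u) + r *\<^sub>R v)) (at r)"
        unfolding g_def by (intro DERIV_along_line) (use fu in \<open>auto simp: fu'_def\<close>)
    qed
    then obtain w where w: "0 < w" "w < t"
      "fu' (x + z *\<^sub>R u + t *\<^sub>R v) - fu' (x + z *\<^sub>R u) = t * g (x + z *\<^sub>R u + w *\<^sub>R v)"
      by auto
    have "\<bar>g (x + z *\<^sub>R u + w *\<^sub>R v) - g x\<bar> < e"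
      using near[of z t w] z w t by (intro d1) auto
    then have "\<bar>g (x + z *\<^sub>R u + w *\<^sub>R v) - g x\<bar> * (t * t) < e * (t * t)"
      using t by (intro mult_strict_right_mono) auto
    moreover have "\<bar>g (x + z *\<^sub>R u + w *\<^sub>R v) - g x\<bar> * (t * t) = \<bar>t * t * (g (x + z *\<^sub>R u + w *\<^sub>R v) - g x)\<bar>"
      by (simp add: abs_mult)
    ultimately have "\<bar>t * t * (g (x + z *\<^sub>R u + w *\<^sub>R v) - g x)\<bar> < e * (t * t)" by simp
    then show ?thesis using z(3) w(3) by (simp add: algebra_simps)
  qed
  moreover have "d > 0" using d1 d2 n by (simp add: d_def)
  ultimately show ?thesis unfolding g_def fu'_def by blast
qed

text \<open>The second difference is symmetric in \<open>u\<close> and \<open>v\<close> and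
  approximates both mixed derivatives. Taking half their distance as the tolerance makes a
  difference between them contradictory.\<close>

lemma second_derivative_symmetric:
  fixes f :: "'e::euclidean_space \<Rightarrow> real"
  assumes S: "open S" "x \<in> S" and f: "Ck_on 2 f S"
  shows "frechet_derivative (\<lambda>q. frechet_derivative f (at q) u) (at x) v
    = frechet_derivative (\<lambda>q. frechet_derivative f (at q) v) (at x) u" (is "?A = ?B")
proof (rule ccontr)
  assume "?A \<noteq> ?B"
  then have e: "\<bar>?A - ?B\<bar> / 2 > 0" by simp
  have f': "\<And>p. p \<in> S \<Longrightarrow> f differentiable (at p)"
    "\<And>p u. p \<in> S \<Longrightarrow> (\<lambda>q. frechet_derivative f (at q) u) differentiable (at p)"
    "\<And>u v. continuous_on S (\<lambda>p. frechet_derivative (\<lambda>q. frechet_derivative f (at q) u) (at p) v)"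
    using f by (auto simp: numeral_2_eq_2)
  obtain d1 d2 where "d1 > 0" "d2 > 0" and
    d1: "\<And>t. 0 < t \<Longrightarrow> t < d1 \<Longrightarrow>
    \<bar>f (x + t *\<^sub>R u + t *\<^sub>R v) - f (x + t *\<^sub>R u) - f (x + t *\<^sub>R v) + f x - t * t * ?A\<bar> < \<bar>?A - ?B\<bar> / 2 * (t * t)" and
    d2: "\<And>t. 0 < t \<Longrightarrow> t < d2 \<Longrightarrow>
    \<bar>f (x + t *\<^sub>R v + t *\<^sub>R u) - f (x + t *\<^sub>R v) - f (x + t *\<^sub>R u) + f x - t * t * ?B\<bar> < \<bar>?A - ?B\<bar> / 2 * (t * t)"
    using second_difference_approximation[OF S f'(1) f'(2) f'(3) e, of u v]
      second_difference_approximation[OF S f'(1) f'(2) f'(3) e, of v u] by blast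
  define t where "t = min d1 d2 / 2"
  have t: "0 < t" "t < d1" "t < d2" using \<open>d1 > 0\<close> \<open>d2 > 0\<close> by (auto simp: t_def)
  have "x + t *\<^sub>R v + t *\<^sub>R u = x + t *\<^sub>R u + t *\<^sub>R v" by (simp add: add_ac)
  then have "\<bar>t * t * ?A - t * t * ?B\<bar> < \<bar>?A - ?B\<bar> * (t * t)"
    using d1[OF t(1,2)] d2[OF t(1,3)] by (simp only:)
  moreover have "\<bar>t * t * ?A - t * t * ?B\<bar> = \<bar>?A - ?B\<bar> * (t * t)"
    by (simp add: abs_mult flip: right_diff_distrib)
  ultimately show False by simp
qed

text \<open>Since \<open>f\<close> vanishes at \<open>x\<close>, continuity of the other factor
  suffices for the product rule.\<close>

lemma has_derivative_mult_vanishing: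
  fixes f g :: "'e::real_normed_vector \<Rightarrow> real"
  assumes f: "(f has_derivative f') (at x)" and "f x = 0" and g: "isCont g x"
  shows "((\<lambda>p. f p * g p) has_derivative (\<lambda>h. f' h * g x)) (at x)"
proof -
  have bl: "bounded_linear f'" using f by (rule has_derivative_bounded_linear)
  obtain C where C: "\<And>h. norm (f' h) \<le> norm h * C" using bounded_linear.bounded[OF bl] by blast
  have 1: "((\<lambda>p. (f p - f' (p - x)) / norm (p - x)) \<longlongrightarrow> 0) (at x)"
    using f \<open>f x = 0\<close> by (simp add: has_derivative_at_within divide_inverse mult.commute)
  have 2: "((\<lambda>p. f' (p - x) / norm (p - x) * (g p - g x)) \<longlongrightarrow> 0) (at x)"
  proof (rule Lim_null_comparison)
    show "\<forall>\<^sub>F p in at x. norm (f' (p - x) / norm (p - x) * (g p - g x)) \<le> C * \<bar>g p - g x\<bar>"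
    proof (rule eventually_at_topological[THEN iffD2, OF exI[of _ UNIV]], intro conjI ballI impI)
      fix p assume "p \<noteq> x"
      then have "\<bar>f' (p - x)\<bar> / norm (p - x) \<le> C"
        using C[of "p - x"] by (simp add: field_simps)
      then have "\<bar>f' (p - x)\<bar> / norm (p - x) * \<bar>g p - g x\<bar> \<le> C * \<bar>g p - g x\<bar>"
        by (rule mult_right_mono) simp
      then show "norm (f' (p - x) / norm (p - x) * (g p - g x)) \<le> C * \<bar>g p - g x\<bar>"
        by (simp add: abs_mult)
    qed auto
    have "((\<lambda>p. g p - g x) \<longlongrightarrow> 0) (at x)" using g by (simp add: isCont_def LIM_zero)
    then show "((\<lambda>p. C * \<bar>g p - g x\<bar>) \<longlongrightarrow> 0) (at x)"
      by (intro tendsto_mult_right_zero tendsto_rabs_zero)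
  qed
  \<comment> \<open>The difference quotient splits into the remainder of \<open>f\<close> times
    \<open>g\<close>, and a bounded quotient times the increment of \<open>g\<close>.\<close>
  have "((\<lambda>p. (f p - f' (p - x)) / norm (p - x) * g p + f' (p - x) / norm (p - x) * (g p - g x)) \<longlongrightarrow> 0 * g x + 0) (at x)"
    using g by (intro tendsto_add tendsto_mult 1 2) (simp add: isCont_def)
  moreover have "(f p - f' (p - x)) / norm (p - x) * g p + f' (p - x) / norm (p - x) * (g p - g x)
     = (f p * g p - f' (p - x) * g x) / norm (p - x)" for p
    by (simp add: divide_inverse algebra_simps)
  ultimately have "((\<lambda>p. (f p * g p - f' (p - x) * g x) / norm (p - x)) \<longlongrightarrow> 0) (at x)" by simp
  then show ?thesis using \<open>f x = 0\<close> bl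
    by (simp add: has_derivative_at_within divide_inverse mult.commute bounded_linear_mult_const
      bounded_linear_const_mult)
qed

text \<open>The solution \<open>w\<close> of the linear system \<open>h p (w p) = b p\<close> is first seen to be bounded near \<open>x\<close>,
  then continuous at \<open>x\<close>. Its coefficients with respect to \<open>h x\<close> differ from \<open>b\<close> by products of
  a function vanishing at \<open>x\<close> and a component of \<open>w\<close>, hence are differentiable.\<close>

lemma differentiable_solution:
  fixes h :: "'e::real_normed_vector \<Rightarrow> 'v::euclidean_space \<Rightarrow> 'v \<Rightarrow> real"
  assumes S: "open S" "x \<in> S" and bilinear_h: "\<And>p. p \<in> S \<Longrightarrow> bilinear (h p)"
    and form: "euclidean_form (h x)"
    and h: "\<And>u v. (\<lambda>p. h p u v) differentiable (at x)"
    and b: "\<And>v. (\<lambda>p. b p v) differentiable (at x)"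
    and w: "\<And>p v. p \<in> S \<Longrightarrow> h p (w p) v = b p v"
  shows "w differentiable (at x)"
proof -
  interpret euclidean_form "h x" by (rule form)
  obtain B where B: "orthonormal B" "card B = DIM('v)" using orthonormal_exists by blast
  \<comment> \<open>Freezing the form at \<open>x\<close> makes the basis \<open>B\<close> usable at
    all nearby points; \<delta> is the resulting error, which vanishes at \<open>x\<close>.\<close>
  define \<delta> where "\<delta> = (\<lambda>p f e. h p f e - h x f e)"
  have \<delta>_diff: "(\<lambda>p. \<delta> p f e) differentiable (at x)" for f e
    unfolding \<delta>_def by (intro differentiable_diff h differentiable_const)
  have coeff: "h x (w p) e = b p e - (\<Sum>f\<in>Basis. \<delta> p f e * (w p \<bullet> f))" if "p \<in> S" for p e
  proof -
    have "h q (w p) e = (\<Sum>f\<in>Basis. h q f e * (w p \<bullet> f))" if "q \<in> S" for q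
    proof -
      have l: "linear (\<lambda>y. h q y e)" using bilinear_h[OF that] by (simp add: bilinear_def)
      have "h q (w p) e = h q (\<Sum>f\<in>Basis. (w p \<bullet> f) *\<^sub>R f) e" by (simp add: euclidean_representation)
      then show ?thesis by (simp only: linear_sum[OF l] linear_cmul[OF l] real_scaleR_def mult.commute)
    qed
    then show ?thesis using w[OF that, of e] that S
      by (simp add: \<delta>_def left_diff_distrib sum_subtractf)
  qed
  have expand: "w p = (\<Sum>e\<in>B. h x (w p) e *\<^sub>R e)" for p by (rule orthonormal_expansion[OF B])
  define M where "M = (\<Sum>e\<in>B. norm e)"
  define \<epsilon> where "\<epsilon> = (\<lambda>p. \<Sum>e\<in>B. norm e * (\<Sum>f\<in>Basis. \<bar>\<delta> p f e\<bar>))"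
  define \<beta> where "\<beta> = (\<lambda>p. \<Sum>e\<in>B. norm e * \<bar>b p e\<bar>)"
  \<comment> \<open>An a priori estimate with \<open>w p\<close> on both sides; the right-hand
    occurrence is absorbed once \<epsilon> is below 1/2.\<close>
  have nw: "norm (w p) \<le> \<beta> p + \<epsilon> p * norm (w p)" if "p \<in> S" for p
  proof -
    have "norm (w p) \<le> (\<Sum>e\<in>B. norm (h x (w p) e *\<^sub>R e))"
      by (subst expand) (rule norm_sum)
    also have "\<dots> \<le> (\<Sum>e\<in>B. norm e * \<bar>b p e\<bar> + norm e * (\<Sum>f\<in>Basis. \<bar>\<delta> p f e\<bar>) * norm (w p))"
    proof (rule sum_mono)
      fix e
      have "\<bar>\<Sum>f\<in>Basis. \<delta> p f e * (w p \<bullet> f)\<bar> \<le> (\<Sum>f\<in>Basis. \<bar>\<delta> p f e\<bar> * norm (w p))"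
        by (rule order_trans[OF sum_abs sum_mono]) (auto simp: abs_mult Basis_le_norm intro: mult_left_mono)
      then have "\<bar>h x (w p) e\<bar> \<le> \<bar>b p e\<bar> + (\<Sum>f\<in>Basis. \<bar>\<delta> p f e\<bar>) * norm (w p)"
        unfolding coeff[OF that] sum_distrib_right by linarith
      then have "\<bar>h x (w p) e\<bar> * norm e \<le> (\<bar>b p e\<bar> + (\<Sum>f\<in>Basis. \<bar>\<delta> p f e\<bar>) * norm (w p)) * norm e"
        by (rule mult_right_mono) simp
      then show "norm (h x (w p) e *\<^sub>R e) \<le> norm e * \<bar>b p e\<bar> + norm e * (\<Sum>f\<in>Basis. \<bar>\<delta> p f e\<bar>) * norm (w p)"
        by (simp add: algebra_simps)
    qed
    also have "\<dots> = \<beta> p + \<epsilon> p * norm (w p)"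
      by (simp add: \<beta>_def \<epsilon>_def sum.distrib sum_distrib_right)
    finally show ?thesis .
  qed
  have \<delta>_lim: "((\<lambda>p. \<delta> p f e) \<longlongrightarrow> 0) (at x)" for f e
    using differentiable_imp_continuous_within[OF \<delta>_diff, of f e]
    by (simp add: continuous_within \<delta>_def)
  have b_lim: "((\<lambda>p. b p e) \<longlongrightarrow> b x e) (at x)" for e
    using differentiable_imp_continuous_within[OF b, of e] by (simp add: continuous_within)
  have "(\<epsilon> \<longlongrightarrow> (\<Sum>e\<in>B. norm e * (\<Sum>f\<in>(Basis::'v set). \<bar>0\<bar>))) (at x)"
    unfolding \<epsilon>_def by (intro tendsto_intros \<delta>_lim)
  then have ev\<epsilon>: "\<forall>\<^sub>F p in at x. \<epsilon> p < 1 / 2" by (rule order_tendstoD) simp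
  have "(\<beta> \<longlongrightarrow> \<beta> x) (at x)"
    unfolding \<beta>_def by (intro tendsto_intros b_lim)
  then have ev\<beta>: "\<forall>\<^sub>F p in at x. \<beta> p < \<beta> x + 1" by (rule order_tendstoD) simp
  have evS: "\<forall>\<^sub>F p in at x. p \<in> S" using S by (simp add: eventually_at_topological) blast
  have bounded: "\<forall>\<^sub>F p in at x. norm (w p) \<le> 2 * (\<beta> x + 1)"
    using ev\<epsilon> ev\<beta> evS
  proof eventually_elim
    case (elim p)
    have "\<epsilon> p * norm (w p) \<le> 1 / 2 * norm (w p)" using elim by (intro mult_right_mono) auto
    with nw[of p] elim show ?case by simp
  qed
  have "((\<lambda>p. \<delta> p f e * (w p \<bullet> f)) \<longlongrightarrow> 0) (at x)" if "f \<in> Basis" for f e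
  proof (rule Lim_null_comparison)
    show "\<forall>\<^sub>F p in at x. norm (\<delta> p f e * (w p \<bullet> f)) \<le> \<bar>\<delta> p f e\<bar> * (2 * (\<beta> x + 1))"
      using bounded
    proof eventually_elim
      case (elim p)
      then have "\<bar>w p \<bullet> f\<bar> \<le> 2 * (\<beta> x + 1)" using Basis_le_norm[OF that, of "w p"] by linarith
      then show ?case by (simp add: abs_mult mult_left_mono)
    qed
    show "((\<lambda>p. \<bar>\<delta> p f e\<bar> * (2 * (\<beta> x + 1))) \<longlongrightarrow> 0) (at x)"
      by (intro tendsto_mult_left_zero tendsto_rabs_zero \<delta>_lim)
  qed
  then have "((\<lambda>p. b p e - (\<Sum>f\<in>Basis. \<delta> p f e * (w p \<bullet> f))) \<longlongrightarrow> b x e - (\<Sum>f\<in>(Basis::'v set). 0)) (at x)" for e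
    by (intro tendsto_intros b_lim) auto
  then have "((\<lambda>p. h x (w p) e) \<longlongrightarrow> b x e - (\<Sum>f\<in>(Basis::'v set). 0)) (at x)" for e
    by (rule Lim_transform_eventually) (use evS in \<open>eventually_elim, simp add: coeff\<close>)
  then have "((\<lambda>p. \<Sum>e\<in>B. h x (w p) e *\<^sub>R e) \<longlongrightarrow> (\<Sum>e\<in>B. b x e *\<^sub>R e)) (at x)"
    by (intro tendsto_intros) simp
  moreover have "(\<Sum>e\<in>B. b x e *\<^sub>R e) = w x" using expand[of x] w[OF S(2)] by simp
  ultimately have "(w \<longlongrightarrow> w x) (at x)" by (simp flip: expand)
  then have cont: "isCont (\<lambda>p. w p \<bullet> f) x" for f by (simp add: isCont_def tendsto_inner)
  have "(\<lambda>p. \<Sum>e\<in>B. (b p e - (\<Sum>f\<in>Basis. \<delta> p f e * (w p \<bullet> f))) *\<^sub>R e) differentiable (at x)"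
  proof -
    \<comment> \<open>The factor \<delta> vanishes at \<open>x\<close>, so the mere continuity of
      \<open>w\<close> established above is enough.\<close>
    have "(\<lambda>p. \<delta> p f e * (w p \<bullet> f)) differentiable (at x)" for f e
      using \<delta>_diff[of f e] has_derivative_mult_vanishing[OF _ _ cont, of "\<lambda>p. \<delta> p f e"]
      by (force simp: differentiable_def \<delta>_def)
    then show ?thesis
      using orthonormal_finite[OF B(1)]
      by (intro differentiable_sum differentiable_scaleR differentiable_diff b differentiable_const ballI) auto
  qed
  moreover have "\<exists>d>0. \<forall>p. dist p x < d \<longrightarrow> p \<in> S" using S by (simp add: open_dist)
  then obtain d where "d > 0" "\<And>p. dist p x < d \<Longrightarrow> p \<in> S" by blast
  ultimately show ?thesis
  proof (elim differentiable_transform_within)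
    fix p assume "dist p x < d"
    then have "p \<in> S" by fact
    then show "(\<Sum>e\<in>B. (b p e - (\<Sum>f\<in>Basis. \<delta> p f e * (w p \<bullet> f))) *\<^sub>R e) = w p"
      using expand[of p] by (simp add: coeff)
  qed auto
qed

section \<open>Calculation rules for derivatives\<close>

lemma frechet_derivative_eqI: "(f has_derivative f') (at x) \<Longrightarrow> frechet_derivative f (at x) = f'"
  by (rule frechet_derivative_at[symmetric])

lemma frechet_derivative_add_apply:
  assumes "f differentiable (at x)" "g differentiable (at x)"
  shows "frechet_derivative (\<lambda>p. f p + g p) (at x) u = frechet_derivative f (at x) u + frechet_derivative g (at x) u"
proof -
  have "((\<lambda>p. f p + g p) has_derivative (\<lambda>u. frechet_derivative f (at x) u + frechet_derivative g (at x) u)) (at x)"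
    using assms unfolding frechet_derivative_works by (rule has_derivative_add)
  then show ?thesis by (simp add: frechet_derivative_eqI)
qed

lemma frechet_derivative_bounded_linear:
  assumes "bounded_linear L" "f differentiable (at x)"
  shows "frechet_derivative (\<lambda>p. L (f p)) (at x) u = L (frechet_derivative f (at x) u)"
proof -
  have "((\<lambda>p. L (f p)) has_derivative (\<lambda>u. L (frechet_derivative f (at x) u))) (at x)"
    using assms(2) unfolding frechet_derivative_works by (rule bounded_linear.has_derivative[OF assms(1)])
  then show ?thesis by (simp add: frechet_derivative_eqI)
qed

section \<open>Levi-Civita connection of a Kaehler metric in a chart\<close>

lemma linear_mult_i: "linear (\<lambda>v. \<i> *s v :: complex^'m::finite)"
  by (rule linearI) (auto simp: vec_eq_iff algebra_simps)

lemma i_i_mult: "\<i> *s (\<i> *s v) = - (v :: complex^'m::finite)"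
  by (simp add: vec_eq_iff vector_smult_assoc)

locale kahler_domain =
  fixes U :: "(complex^'m::finite) set"
    and H :: "complex^'m \<Rightarrow> complex^'m \<Rightarrow> complex^'m \<Rightarrow> real"
  assumes open_U: "open U"
    and smooth: "smooth_on (\<lambda>x. H x u v) U"
    and H_bilinear: "x \<in> U \<Longrightarrow> bilinear (H x)"
    and H_sym: "x \<in> U \<Longrightarrow> H x u v = H x v u"
    and H_pos: "x \<in> U \<Longrightarrow> u \<noteq> 0 \<Longrightarrow> H x u u > 0"
    and H_J: "x \<in> U \<Longrightarrow> H x (\<i> *s u) (\<i> *s v) = H x u v"
    and closed: "x \<in> U \<Longrightarrow>
          frechet_derivative (\<lambda>p. H p (\<i> *s v) w) (at x) u +
          frechet_derivative (\<lambda>p. H p (\<i> *s w) u) (at x) v +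
          frechet_derivative (\<lambda>p. H p (\<i> *s u) v) (at x) w = 0"
begin

lemma form: "x \<in> U \<Longrightarrow> euclidean_form (H x)"
  by (rule euclidean_form.intro) (rule H_bilinear H_sym H_pos; assumption)+

lemma C2: "Ck_on 2 (\<lambda>p. H p u v) U"
  using smooth by (simp add: smooth_on_def)

lemma H_diff: "x \<in> U \<Longrightarrow> (\<lambda>p. H p u v) differentiable (at x)"
  and dH_diff: "x \<in> U \<Longrightarrow> (\<lambda>p. frechet_derivative (\<lambda>q. H q u v) (at p) w) differentiable (at x)"
  using C2 by (auto simp: numeral_2_eq_2)

text \<open>The algebraic identities for the metric hold only on \<open>U\<close>; openness of
  \<open>U\<close> allows them to be differentiated.\<close>

lemma local_eq:
  assumes "x \<in> U" "f differentiable (at x)" "\<And>p. p \<in> U \<Longrightarrow> f p = g p"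
  shows "g differentiable (at x)" "frechet_derivative g (at x) = frechet_derivative f (at x)"
proof -
  show "frechet_derivative g (at x) = frechet_derivative f (at x)"
    using frechet_derivative_transform_within_open[OF assms(2) open_U assms(1,3)] by simp
  show "g differentiable (at x)"
    using has_derivative_transform_within_open[of f _ x UNIV U g, OF _ open_U assms(1,3)] assms(2)
    unfolding differentiable_def by blast
qed

abbreviation dH where "dH x w u v \<equiv> frechet_derivative (\<lambda>p. H p u v) (at x) w"

lemmas H_simps = bilinear_ladd[OF H_bilinear] bilinear_radd[OF H_bilinear] bilinear_lsub[OF H_bilinear]
  bilinear_rsub[OF H_bilinear] bilinear_lmul[OF H_bilinear] bilinear_rmul[OF H_bilinear]
  bilinear_lneg[OF H_bilinear] bilinear_rneg[OF H_bilinear]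

section \<open>First derivatives of the metric and Christoffel symbols\<close>

lemma dH_linear1: "x \<in> U \<Longrightarrow> linear (\<lambda>w. dH x w u v)"
  by (rule linear_frechet_derivative) (rule H_diff)

lemma dH_linear2:
  assumes x: "x \<in> U" shows "linear (\<lambda>u. dH x w u v)"
proof (rule linearI)
  fix u u'
  have "(\<lambda>p. H p u v + H p u' v) differentiable (at x)" using x by (intro differentiable_add H_diff)
  from local_eq(2)[OF x this, of "\<lambda>p. H p (u + u') v"]
  show "dH x w (u + u') v = dH x w u v + dH x w u' v"
    by (simp add: H_simps frechet_derivative_add_apply H_diff x)
next
  fix c u
  have "(\<lambda>p. c *\<^sub>R H p u v) differentiable (at x)" using x by (intro differentiable_scaleR H_diff differentiable_const)
  from local_eq(2)[OF x this, of "\<lambda>p. H p (c *\<^sub>R u) v"]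
  show "dH x w (c *\<^sub>R u) v = c *\<^sub>R dH x w u v"
    using frechet_derivative_bounded_linear[OF bounded_linear_scaleR_right H_diff[OF x]] by (simp add: H_simps)
qed

lemma dH_sym: "x \<in> U \<Longrightarrow> dH x w u v = dH x w v u"
  by (rule fun_cong[OF local_eq(2)[OF _ H_diff]]) (auto intro: H_sym)

lemma dH_linear3:
  assumes "x \<in> U" shows "linear (dH x w u)"
proof -
  have "dH x w u = (\<lambda>v. dH x w v u)" by (rule ext) (rule dH_sym[OF assms])
  with dH_linear2[OF assms] show ?thesis by simp
qed

text \<open>The right-hand side is linear in \<open>z\<close>, so the Riesz representation yields
  the unique vector that the definition describes.\<close>

lemma christoffel_koszul:
  assumes x: "x \<in> U"
  shows "2 * H x (christoffel H x u v) z = dH x u v z + dH x v u z - dH x z u v"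
proof -
  interpret euclidean_form "H x" by (rule form[OF x])
  have lin: "linear (\<lambda>z. (1/2) *\<^sub>R (dH x u v z + dH x v u z - dH x z u v))"
    by (intro linear_compose_scale_right linear_compose_sub linear_compose_add
        dH_linear1[OF x] dH_linear3[OF x])
  have "(H x w z = (1/2) *\<^sub>R (dH x u v z + dH x v u z - dH x z u v))
      \<longleftrightarrow> (2 * H x w z = dH x u v z + dH x v u z - dH x z u v)" for w z
    by auto
  with riesz[OF lin] have "\<exists>!w. \<forall>z. 2 * H x w z = dH x u v z + dH x v u z - dH x z u v"
    by (simp only:)
  from theI'[OF this] show ?thesis unfolding christoffel_def by blast
qed

lemma christoffel_eqI:
  assumes "x \<in> U" "\<And>z. 2 * H x w z = dH x u v z + dH x v u z - dH x z u v"
  shows "christoffel H x u v = w"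
proof -
  interpret euclidean_form "H x" by (rule form[OF assms(1)])
  show ?thesis
  proof (rule eqI)
    show "H x (christoffel H x u v) z = H x w z" for z
      using christoffel_koszul[OF assms(1), of u v z] assms(2)[of z] by linarith
  qed
qed

lemma christoffel_sym:
  assumes x: "x \<in> U" shows "christoffel H x u v = christoffel H x v u"
proof (rule christoffel_eqI[OF x])
  show "2 * H x (christoffel H x v u) z = dH x u v z + dH x v u z - dH x z u v" for z
    using christoffel_koszul[OF x, of v u z] dH_sym[OF x, of u v z] by linarith
qed

lemma christoffel_linear1:
  assumes x: "x \<in> U" shows "linear (\<lambda>u. christoffel H x u v)"
proof (rule linearI)
  note lin = linear_add[OF dH_linear1[OF x]] linear_add[OF dH_linear2[OF x]] linear_add[OF dH_linear3[OF x]]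
    linear_cmul[OF dH_linear1[OF x]] linear_cmul[OF dH_linear2[OF x]] linear_cmul[OF dH_linear3[OF x]]
  show "christoffel H x (u + u') v = christoffel H x u v + christoffel H x u' v" for u u'
  proof (rule christoffel_eqI[OF x])
    show "2 * H x (christoffel H x u v + christoffel H x u' v) z =
      dH x (u + u') v z + dH x v (u + u') z - dH x z (u + u') v" for z
      unfolding lin using christoffel_koszul[OF x, of u v z] christoffel_koszul[OF x, of u' v z]
      by (simp add: H_simps x algebra_simps)
  qed
  show "christoffel H x (c *\<^sub>R u) v = c *\<^sub>R christoffel H x u v" for c u
  proof (rule christoffel_eqI[OF x])
    have "2 * H x (c *\<^sub>R christoffel H x u v) z = c * (2 * H x (christoffel H x u v) z)" for z
      by (simp add: H_simps x)
    then show "2 * H x (c *\<^sub>R christoffel H x u v) z =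
      dH x (c *\<^sub>R u) v z + dH x v (c *\<^sub>R u) z - dH x z (c *\<^sub>R u) v" for z
      unfolding lin christoffel_koszul[OF x] by (simp add: algebra_simps)
  qed
qed

lemma christoffel_linear2:
  assumes x: "x \<in> U" shows "linear (christoffel H x u)"
proof -
  have "christoffel H x u = (\<lambda>v. christoffel H x v u)" by (rule ext) (rule christoffel_sym[OF x])
  with christoffel_linear1[OF x, of u] show ?thesis by simp
qed

text \<open>Adding the Koszul formulas for (u,v,w) and (u,w,v) cancels every derivative except those
  along \<open>u\<close>.\<close>

lemma metric_compatible:
  assumes x: "x \<in> U"
  shows "dH x u v w = H x (christoffel H x u v) w + H x v (christoffel H x u w)"
  using christoffel_koszul[OF x, of u v w] christoffel_koszul[OF x, of u w v]
    H_sym[OF x, of v "christoffel H x u w"] dH_sym[OF x, of v w u] dH_sym[OF x, of u w v] dH_sym[OF x, of u v w] by linarith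

lemma H_J_left:
  assumes x: "x \<in> U" shows "H x (\<i> *s u) v = - H x u (\<i> *s v)"
  using H_J[OF x, of "\<i> *s u" v] by (simp add: i_i_mult H_simps x)

lemma dH_J_left:
  assumes x: "x \<in> U" shows "dH x w (\<i> *s u) v = - dH x w u (\<i> *s v)"
proof -
  have d: "(\<lambda>p. - H p u (\<i> *s v)) differentiable (at x)"
    by (intro differentiable_minus H_diff x)
  have "dH x w (\<i> *s u) v = frechet_derivative (\<lambda>p. - H p u (\<i> *s v)) (at x) w"
    by (rule fun_cong[OF local_eq(2)[OF x d]]) (simp add: H_J_left)
  also have "\<dots> = - dH x w u (\<i> *s v)"
    by (rule frechet_derivative_bounded_linear[of uminus])
      (auto intro: H_diff x bounded_linear_minus bounded_linear_ident)
  finally show ?thesis .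
qed

text \<open>The complex structure is parallel. Closedness of the Kaehler form enters twice: for the
  vectors \<open>u\<close>, \<open>v\<close>, \<open>z\<close>, and with \<open>v\<close> and
  \<open>z\<close> multiplied by \<i>. Together these relate the Koszul expression for \<i> v to
  that for \<open>v\<close>, paired with \<i> z.\<close>

lemma christoffel_J:
  assumes x: "x \<in> U"
  shows "christoffel H x u (\<i> *s v) = \<i> *s christoffel H x u v"
proof (rule christoffel_eqI[OF x])
  fix z
  have n: "dH x a (- b) c = - dH x a b c" for a b c
    by (rule linear_neg[OF dH_linear2[OF x]])
  have "dH x (\<i> *s v) u z - dH x u z (\<i> *s v) - dH x (\<i> *s z) v u = 0"
    using closed[OF x, of u "\<i> *s z" "\<i> *s v"]
    unfolding i_i_mult n dH_J_left[OF x, of u "\<i> *s z" "\<i> *s v"]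
      linear_neg[OF dH_linear3[OF x]] by simp
  moreover have "- dH x v u (\<i> *s z) - dH x u z (\<i> *s v) + dH x z (\<i> *s v) u = 0"
    using closed[OF x, of u z v] unfolding dH_J_left[OF x, of u z v] dH_J_left[OF x, of z v u] by linarith
  moreover have "dH x u (\<i> *s v) z = - dH x u v (\<i> *s z)" by (rule dH_J_left[OF x])
  moreover have "dH x z (\<i> *s v) u = dH x z u (\<i> *s v)" "dH x (\<i> *s z) v u = dH x (\<i> *s z) u v"
    by (rule dH_sym[OF x])+
  moreover have "2 * H x (\<i> *s christoffel H x u v) z = - (dH x u v (\<i> *s z) + dH x v u (\<i> *s z) - dH x (\<i> *s z) u v)"
    unfolding christoffel_koszul[OF x, symmetric] H_J_left[OF x] by simp
  ultimately show "2 * H x (\<i> *s christoffel H x u v) z = dH x u (\<i> *s v) z + dH x (\<i> *s v) u z - dH x z u (\<i> *s v)"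
    by linarith
qed

text \<open>The symbols are known only implicitly, so their regularity comes from the linear system
  given by the Koszul formula.\<close>

lemma christoffel_diff:
  assumes x: "x \<in> U" shows "(\<lambda>p. christoffel H p u v) differentiable (at x)"
proof (rule differentiable_solution[OF open_U x, where h = H
      and b = "\<lambda>p z. (dH p u v z + dH p v u z - dH p z u v) / 2"])
  show "(\<lambda>p. (dH p u v z + dH p v u z - dH p z u v) / 2) differentiable (at x)" for z
    by (intro differentiable_divide differentiable_diff differentiable_add dH_diff x differentiable_const) simp
  show "H p (christoffel H p u v) z = (dH p u v z + dH p v u z - dH p z u v) / 2" if "p \<in> U" for p z
    using christoffel_koszul[OF that, of u v z] by simp
qed (auto intro: H_bilinear form[OF x] H_diff x)

abbreviation d\<Gamma> where "d\<Gamma> x w u v \<equiv> frechet_derivative (\<lambda>p. christoffel H p u v) (at x) w"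

section \<open>Derivatives of the Christoffel symbols\<close>

lemma d\<Gamma>_linear1: "x \<in> U \<Longrightarrow> linear (\<lambda>w. d\<Gamma> x w u v)"
  by (rule linear_frechet_derivative) (rule christoffel_diff)

lemma d\<Gamma>_sym:
  assumes x: "x \<in> U" shows "d\<Gamma> x w u v = d\<Gamma> x w v u"
  by (rule fun_cong[OF local_eq(2)[OF x christoffel_diff[OF x]]]) (rule christoffel_sym)

lemma d\<Gamma>_linear3:
  assumes x: "x \<in> U" shows "linear (d\<Gamma> x w u)"
proof (rule linearI)
  fix v v'
  have "(\<lambda>p. christoffel H p u v + christoffel H p u v') differentiable (at x)"
    by (intro differentiable_add christoffel_diff x)
  from local_eq(2)[OF x this, of "\<lambda>p. christoffel H p u (v + v')"]
  show "d\<Gamma> x w u (v + v') = d\<Gamma> x w u v + d\<Gamma> x w u v'"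
    by (simp add: linear_add[OF christoffel_linear2] frechet_derivative_add_apply christoffel_diff x)
next
  fix c v
  have "(\<lambda>p. c *\<^sub>R christoffel H p u v) differentiable (at x)"
    by (intro differentiable_scaleR christoffel_diff differentiable_const x)
  from local_eq(2)[OF x this, of "\<lambda>p. christoffel H p u (c *\<^sub>R v)"]
  show "d\<Gamma> x w u (c *\<^sub>R v) = c *\<^sub>R d\<Gamma> x w u v"
    using frechet_derivative_bounded_linear[OF bounded_linear_scaleR_right christoffel_diff[OF x]]
    by (simp add: linear_cmul[OF christoffel_linear2])
qed

lemma d\<Gamma>_linear2:
  assumes x: "x \<in> U" shows "linear (\<lambda>u. d\<Gamma> x w u v)"
proof -
  have "(\<lambda>u. d\<Gamma> x w u v) = d\<Gamma> x w v" by (rule ext) (rule d\<Gamma>_sym[OF x])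
  with d\<Gamma>_linear3[OF x] show ?thesis by simp
qed

lemma d\<Gamma>_J:
  assumes x: "x \<in> U" shows "d\<Gamma> x w u (\<i> *s v) = \<i> *s d\<Gamma> x w u v"
proof -
  have bl: "bounded_linear (\<lambda>v. \<i> *s v :: complex^'m)"
    by (rule linear_conv_bounded_linear[THEN iffD1, OF linear_mult_i])
  have d: "(\<lambda>p. \<i> *s christoffel H p u v) differentiable (at x)"
    using bounded_linear.has_derivative[OF bl] christoffel_diff[OF x, of u v] unfolding differentiable_def by blast
  have "d\<Gamma> x w u (\<i> *s v) = frechet_derivative (\<lambda>p. \<i> *s christoffel H p u v) (at x) w"
    by (rule fun_cong[OF local_eq(2)[OF x d]]) (simp add: christoffel_J)
  also have "\<dots> = \<i> *s d\<Gamma> x w u v"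
    by (rule frechet_derivative_bounded_linear[OF bl christoffel_diff[OF x]])
  finally show ?thesis .
qed

text \<open>Expanding \<open>f p\<close> along the standard basis reduces the claim to metric
  coefficients with constant arguments.\<close>

lemma H_product_rule:
  assumes x: "x \<in> U" and f: "f differentiable (at x)"
  shows "(\<lambda>p. H p (f p) z) differentiable (at x)"
    and "frechet_derivative (\<lambda>p. H p (f p) z) (at x) u
      = dH x u (f x) z + H x (frechet_derivative f (at x) u) z"
proof -
  let ?f' = "frechet_derivative f (at x)"
  have expand: "L y = (\<Sum>b\<in>Basis. (y \<bullet> b) * L b)" if "linear L" for L :: "complex^'m \<Rightarrow> real" and y
  proof -
    have "L y = L (\<Sum>b\<in>Basis. (y \<bullet> b) *\<^sub>R b)" by (simp add: euclidean_representation)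
    then show ?thesis by (simp only: linear_sum[OF that] linear_cmul[OF that] real_scaleR_def)
  qed
  have lin: "linear (\<lambda>y. H p y z)" if "p \<in> U" for p
    using H_bilinear[OF that] by (simp add: bilinear_def)
  have D: "(f has_derivative ?f') (at x)" using f by (simp add: frechet_derivative_works)
  have "((\<lambda>p. \<Sum>b\<in>Basis. (f p \<bullet> b) * H p b z) has_derivative
     (\<lambda>u. \<Sum>b\<in>Basis. (f x \<bullet> b) * dH x u b z + (?f' u \<bullet> b) * H x b z)) (at x)"
    using H_diff[OF x] unfolding frechet_derivative_works
    by (intro has_derivative_sum has_derivative_mult has_derivative_inner_left D)
  moreover have "(\<Sum>b\<in>Basis. (f x \<bullet> b) * dH x u b z + (?f' u \<bullet> b) * H x b z)
      = dH x u (f x) z + H x (?f' u) z" for u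
    unfolding sum.distrib expand[OF dH_linear2[OF x], symmetric] expand[OF lin[OF x], symmetric] ..
  ultimately have "((\<lambda>p. \<Sum>b\<in>Basis. (f p \<bullet> b) * H p b z) has_derivative
     (\<lambda>u. dH x u (f x) z + H x (?f' u) z)) (at x)" by simp
  then have *: "((\<lambda>p. H p (f p) z) has_derivative (\<lambda>u. dH x u (f x) z + H x (?f' u) z)) (at x)"
    by (rule has_derivative_transform_within_open[OF _ open_U x]) (rule expand[OF lin, symmetric])
  show "(\<lambda>p. H p (f p) z) differentiable (at x)" using * by (auto simp: differentiable_def)
  show "frechet_derivative (\<lambda>p. H p (f p) z) (at x) u = dH x u (f x) z + H x (?f' u) z"
    by (simp add: frechet_derivative_eqI[OF *])
qed

text \<open>Metric compatibility differentiated once more. The two products of Christoffel symbols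
  on the last line are together symmetric in \<open>u\<close> and \<open>v\<close>, so they
  disappear on antisymmetrizing, and curvature terms remain.\<close>

lemma second_derivative_H:
  assumes x: "x \<in> U"
  shows "frechet_derivative (\<lambda>p. dH p v w z) (at x) u =
    H x (d\<Gamma> x u v w + christoffel H x u (christoffel H x v w)) z
    + H x (d\<Gamma> x u v z + christoffel H x u (christoffel H x v z)) w
    + H x (christoffel H x v w) (christoffel H x u z) + H x (christoffel H x v z) (christoffel H x u w)"
proof -
  have d: "(\<lambda>p. H p (christoffel H p v w) z) differentiable (at x)" for w z
    by (rule H_product_rule(1)[OF x christoffel_diff[OF x]])
  have "dH p v w z = H p (christoffel H p v w) z + H p (christoffel H p v z) w" if "p \<in> U" for p
    using metric_compatible[OF that, of w z v] H_sym[OF that, of w] by simp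
  then have "frechet_derivative (\<lambda>p. dH p v w z) (at x) u
    = frechet_derivative (\<lambda>p. H p (christoffel H p v w) z + H p (christoffel H p v z) w) (at x) u"
    by (intro fun_cong[OF local_eq(2)[OF x differentiable_add[OF d d]]]) simp
  also have "\<dots> = frechet_derivative (\<lambda>p. H p (christoffel H p v w) z) (at x) u
     + frechet_derivative (\<lambda>p. H p (christoffel H p v z) w) (at x) u"
    by (rule frechet_derivative_add_apply[OF d d])
  finally show ?thesis
    unfolding H_product_rule(2)[OF x christoffel_diff[OF x]] metric_compatible[OF x]
    by (simp add: H_simps x)
qed

lemma local_curv_kahler:
  assumes x: "x \<in> U"
  shows "kahler_curvature (H x) (\<lambda>v. \<i> *s v) (\<lambda>X Y Z W. H x (local_curv H x X Y Z) W)"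
proof -
  interpret euclidean_form "H x" by (rule form[OF x])
  note \<Gamma>l = christoffel_linear1[OF x] christoffel_linear2[OF x]
  note d\<Gamma>l = d\<Gamma>_linear1[OF x] d\<Gamma>_linear2[OF x] d\<Gamma>_linear3[OF x]
  have comp: "linear (\<lambda>y. christoffel H x u (f y))" "linear (\<lambda>y. christoffel H x (f y) u)"
    if "linear f" for u and f :: "complex^'m \<Rightarrow> complex^'m"
    using linear_compose[OF that \<Gamma>l(1)] linear_compose[OF that \<Gamma>l(2)] by (simp_all add: o_def)
  have comp_H: "linear (\<lambda>y. H x (f y) w)" if "linear f" for w and f :: "complex^'m \<Rightarrow> complex^'m"
    using linear_compose[OF that linear_l] by (simp add: o_def)
  show ?thesis
  proof (rule kahler_curvature.intro[OF form[OF x] kahler_curvature_axioms.intro])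
    show "linear (\<lambda>v. \<i> *s v :: complex^'m)" by (rule linear_mult_i)
    show "\<i> *s (\<i> *s v) = - v" for v :: "complex^'m" by (rule i_i_mult)
    show "H x (\<i> *s u) (\<i> *s v) = H x u v" for u v by (rule H_J[OF x])
    show "linear (\<lambda>X. H x (local_curv H x X Y Z) W)" "linear (\<lambda>Y. H x (local_curv H x X Y Z) W)"
      "linear (\<lambda>Z. H x (local_curv H x X Y Z) W)" for X Y Z W
      unfolding local_curv_def
      by (rule comp_H, intro linear_compose_sub linear_compose_add comp linear_ident \<Gamma>l d\<Gamma>l)+
    show "linear (\<lambda>W. H x (local_curv H x X Y Z) W)" for X Y Z by (rule linear_r)
    show "H x (local_curv H x X Y Z) W = - H x (local_curv H x Y X Z) W" for X Y Z W
      unfolding local_curv_def h_simps by simp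
    have "local_curv H x X Y (\<i> *s Z) = \<i> *s local_curv H x X Y Z" for X Y Z
      unfolding local_curv_def d\<Gamma>_J[OF x] christoffel_J[OF x]
      by (simp add: vec_eq_iff algebra_simps)
    then show "H x (local_curv H x X Y (\<i> *s Z)) (\<i> *s W) = H x (local_curv H x X Y Z) W" for X Y Z W
      by (simp add: H_J[OF x])
    \<comment> \<open>The first Bianchi identity is a pure cancellation once the symmetry of the
      Christoffel symbols is used.\<close>
    have "local_curv H x X Y Z + local_curv H x Y Z X + local_curv H x Z X Y = 0" for X Y Z
      unfolding local_curv_def d\<Gamma>_sym[OF x, of Z Y X] d\<Gamma>_sym[OF x, of X Z Y] d\<Gamma>_sym[OF x, of Y X Z]
        christoffel_sym[OF x, of Z Y] christoffel_sym[OF x, of Y X] christoffel_sym[OF x, of Z X]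
      by simp
    then show "H x (local_curv H x X Y Z) W + H x (local_curv H x Y Z X) W + H x (local_curv H x Z X Y) W = 0"
      for X Y Z W unfolding h_simps(1)[symmetric] by (simp only: h_simps)
    show "H x (local_curv H x X Y Z) W = - H x (local_curv H x X Y W) Z" for X Y Z W
    proof -
      \<comment> \<open>Substituting \<open>second_derivative_H\<close> on both sides turns this
        symmetry into the vanishing of R(X,Y,Z,W) + R(X,Y,W,Z).\<close>
      have "frechet_derivative (\<lambda>p. dH p Y Z W) (at x) X = frechet_derivative (\<lambda>p. dH p X Z W) (at x) Y"
        by (rule second_derivative_symmetric[OF open_U x C2])
      then show ?thesis
        unfolding second_derivative_H[OF x] local_curv_def h_simps
        using H_sym[OF x, of "christoffel H x Y Z" "christoffel H x X W"]
          H_sym[OF x, of "christoffel H x X Z" "christoffel H x Y W"] by linarith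
    qed
  qed
qed

end

section \<open>Tangent vectors in a chart\<close>

lemma cext2_pair:
  "cext2 B (X, Y) (X', Y') = complex_of_real (B X X' - B Y Y') + \<i> * complex_of_real (B X Y' + B Y X')"
  by (simp add: cext2_def algebra_simps)

text \<open>Only terms with an even number of second components are real: two of them contribute the
  factor -1, four the factor 1.\<close>

lemma Re_cext4_pair:
  "Re (cext4 T (X1, Y1) (X2, Y2) (X3, Y3) (X4, Y4)) =
    T X1 X2 X3 X4 + T Y1 Y2 Y3 Y4 - T Y1 Y2 X3 X4 - T Y1 X2 Y3 X4 - T Y1 X2 X3 Y4
    - T X1 Y2 Y3 X4 - T X1 Y2 X3 Y4 - T X1 X2 Y3 Y4"
  by (simp add: cext4_def)

locale complex_manifold_point =
  fixes M :: "'a topology" and A :: "('a, 'm::finite) chart set" and y :: 'a and c :: "('a, 'm) chart"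
  assumes manifold: "complex_manifold M A" and c: "c \<in> A" "y \<in> fst c"
begin

section \<open>Charts and derivatives of transition maps\<close>

lemma is_chart: "d \<in> A \<Longrightarrow> is_chart M d"
  using manifold by (simp add: complex_manifold_def)

lemma chart_inj:
  assumes "d \<in> A" shows "inj_on (snd d) (fst d)"
proof -
  have d: "openin M (fst d)" "homeomorphic_map (subtopology M (fst d)) (top_of_set (snd d ` fst d)) (snd d)"
    using is_chart[OF assms] by (auto simp: is_chart_def)
  have "topspace (subtopology M (fst d)) = fst d"
    using openin_subset[OF d(1)] by (rule topspace_subtopology_subset)
  with homeomorphic_imp_injective_map[OF d(2)] show ?thesis by simp
qed

lemma chart_inv: "d \<in> A \<Longrightarrow> q \<in> fst d \<Longrightarrow> inv_into (fst d) (snd d) (snd d q) = q"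
  by (intro inv_into_f_f chart_inj)

lemma transition_apply: "d \<in> A \<Longrightarrow> q \<in> fst d \<Longrightarrow> transition d e (snd d q) = snd e q"
  by (simp add: transition_def chart_inv)

lemma open_overlap:
  assumes "d \<in> A" "e \<in> A" shows "open (snd d ` (fst d \<inter> fst e))"
proof -
  have d: "openin M (fst d)" "open (snd d ` fst d)"
    "homeomorphic_map (subtopology M (fst d)) (top_of_set (snd d ` fst d)) (snd d)"
    using is_chart[OF assms(1)] by (auto simp: is_chart_def)
  have "openin M (fst e)" using is_chart[OF assms(2)] by (simp add: is_chart_def)
  then have "openin (subtopology M (fst d)) (fst d \<inter> fst e)"
    by (simp add: openin_subtopology_Int2)
  then have "openin (top_of_set (snd d ` fst d)) (snd d ` (fst d \<inter> fst e))"
    using homeomorphic_imp_open_map[OF d(3)] by (simp add: open_map_def)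
  then show ?thesis using d(2) openin_open_trans by blast
qed

lemma transition_derivative:
  assumes "d \<in> A" "e \<in> A" "y \<in> fst d" "y \<in> fst e"
  defines "D \<equiv> frechet_derivative (transition d e) (at (snd d y))"
  shows "(transition d e has_derivative D) (at (snd d y))" "D (\<i> *s v) = \<i> *s D v"
proof -
  have "snd d y \<in> snd d ` (fst d \<inter> fst e)" using assms by blast
  moreover have "holomorphic_map_on (transition d e) (snd d ` (fst d \<inter> fst e))"
    using manifold assms(1,2) by (simp add: complex_manifold_def)
  ultimately obtain D' where D': "(transition d e has_derivative D') (at (snd d y))" "\<And>v. D' (\<i> *s v) = \<i> *s D' v"
    unfolding holomorphic_map_on_def by blast
  then have "D = D'" unfolding D_def by (simp add: frechet_derivative_eqI)
  with D' show "(transition d e has_derivative D) (at (snd d y))" "D (\<i> *s v) = \<i> *s D v" by auto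
qed

lemma transition_derivative_self: "frechet_derivative (transition c c) (at (snd c y)) = (\<lambda>u. u)"
proof (rule frechet_derivative_eqI)
  show "(transition c c has_derivative (\<lambda>u. u)) (at (snd c y))"
    by (rule has_derivative_transform_within_open[OF has_derivative_ident open_overlap[OF c(1) c(1)]])
      (use c in \<open>auto simp: transition_apply\<close>)
qed

text \<open>The cocycle rule, by the chain rule; it makes the family built by \<open>tvec_of\<close>
  a tangent vector.\<close>

lemma transition_derivative_comp:
  assumes "d \<in> A" "e \<in> A" "y \<in> fst d" "y \<in> fst e"
  shows "frechet_derivative (transition d e) (at (snd d y)) (frechet_derivative (transition c d) (at (snd c y)) u)
    = frechet_derivative (transition c e) (at (snd c y)) u"
proof -
  let ?D1 = "frechet_derivative (transition c d) (at (snd c y))"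
  let ?D2 = "frechet_derivative (transition d e) (at (snd d y))"
  have "(transition d e has_derivative ?D2) (at (transition c d (snd c y)))"
    using transition_derivative(1)[OF assms] c by (simp add: transition_apply)
  then have "((\<lambda>p. transition d e (transition c d p)) has_derivative (\<lambda>u. ?D2 (?D1 u))) (at (snd c y))"
    by (intro has_derivative_compose[OF transition_derivative(1)]) (use assms c in auto)
  then have "(transition c e has_derivative (\<lambda>u. ?D2 (?D1 u))) (at (snd c y))"
    by (rule has_derivative_transform_within_open[OF _ open_overlap[OF c(1) assms(1)]])
      (use assms c in \<open>auto simp: transition_apply\<close>)
  then show ?thesis by (simp add: frechet_derivative_eqI)
qed

section \<open>Tangent vectors as coordinate vectors in one chart\<close>

lemma tvec_of_in: "tvec_of A c y u \<in> tangent_space A y"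
  unfolding tangent_space_def mem_Collect_eq
proof (intro conjI ballI allI impI)
  fix d e assume "d \<in> A" "e \<in> A" "y \<in> fst d" "y \<in> fst e"
  then show "tvec_of A c y u e = frechet_derivative (transition d e) (at (snd d y)) (tvec_of A c y u d)"
    by (simp add: tvec_of_def transition_derivative_comp)
qed (auto simp: tvec_of_def)

lemma tvec_of_chart: "tvec_of A c y u c = u"
  using c by (simp add: tvec_of_def transition_derivative_self)

lemma tvec_of_eq:
  assumes X: "X \<in> tangent_space A y" shows "tvec_of A c y (X c) = X"
proof
  fix d
  show "tvec_of A c y (X c) d = X d"
  proof (cases "d \<in> A \<and> y \<in> fst d")
    case True
    then have "X d = frechet_derivative (transition c d) (at (snd c y)) (X c)"
      using X c unfolding tangent_space_def by blast
    with True show ?thesis by (simp add: tvec_of_def)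
  next
    case False
    then have "X d = 0" using X unfolding tangent_space_def by blast
    with False show ?thesis by (auto simp: tvec_of_def)
  qed
qed

lemma tangent_eqI:
  assumes "X \<in> tangent_space A y" "Y \<in> tangent_space A y" "X c = Y c"
  shows "X = Y"
proof -
  have "X = tvec_of A c y (Y c)" by (subst assms(3)[symmetric]) (rule tvec_of_eq[OF assms(1), symmetric])
  then show ?thesis by (simp only: tvec_of_eq[OF assms(2)])
qed

lemma acs_tvec_of: "acs (tvec_of A c y u) = tvec_of A c y (\<i> *s u)"
proof
  show "acs (tvec_of A c y u) d = tvec_of A c y (\<i> *s u) d" for d
    using transition_derivative(2)[OF c(1) _ c(2), of d u] by (simp add: acs_def tvec_of_def)
qed

lemma neg_tvec_of: "(\<lambda>d. - tvec_of A c y u d) = tvec_of A c y (- u)"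
proof
  show "- tvec_of A c y u d = tvec_of A c y (- u) d" for d
    using linear_neg[OF has_derivative_linear[OF transition_derivative(1)[OF c(1) _ c(2)]], of d u]
    by (simp add: tvec_of_def)
qed

lemma local_metric_point:
  assumes "X \<in> tangent_space A y" "Y \<in> tangent_space A y"
  shows "g y X Y = local_metric A g c (snd c y) (X c) (Y c)"
  using c by (simp add: local_metric_def chart_inv tvec_of_eq assms)

text \<open>The vector u - \<surd>-1 C u, without the factor that would normalize it.\<close>

definition T10_of :: "complex^'m \<Rightarrow> ('a, 'm) ctvec" where
  "T10_of u = (tvec_of A c y u, tvec_of A c y (- (\<i> *s u)))"

lemma T10_space_eq: "T10_space A y = range T10_of"
proof (intro equalityI subsetI)
  fix Z assume "Z \<in> T10_space A y"
  then obtain X Y where Z: "Z = (X, Y)" and X: "X \<in> tangent_space A y" and Y: "Y \<in> tangent_space A y"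
    and acs: "acs X = (\<lambda>d. - Y d)"
    by (auto simp: T10_space_def)
  \<comment> \<open>The first component of the (1,0) condition alone determines \<open>Y\<close>
    from \<open>X\<close>.\<close>
  have "Y c = - (\<i> *s X c)" using fun_cong[OF acs, of c] by (simp add: acs_def)
  then have "Y = tvec_of A c y (- (\<i> *s X c))" using tvec_of_eq[OF Y] by simp
  then have "Z = T10_of (X c)" using tvec_of_eq[OF X] by (simp add: Z T10_of_def)
  then show "Z \<in> range T10_of" by blast
next
  fix Z assume "Z \<in> range T10_of"
  then obtain u where "Z = T10_of u" by blast
  then show "Z \<in> T10_space A y"
    by (simp add: T10_space_def T10_of_def tvec_of_in acs_tvec_of neg_tvec_of i_i_mult
        vector_smult_rneg)
qed

lemma ctvec_cnj_T10_of: "ctvec_cnj (T10_of u) = (tvec_of A c y u, tvec_of A c y (\<i> *s u))"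
  by (simp add: ctvec_cnj_def T10_of_def neg_tvec_of)

end

section \<open>Orthogonal Ricci curvature at a point\<close>

locale kahler_manifold_point =
  fixes M :: "'a topology" and A :: "('a, 'm::finite) chart set" and g :: "('a, 'm) metric" and y :: 'a
  assumes kahler: "kahler_manifold M A g" and y: "y \<in> topspace M"
begin

abbreviation "ch \<equiv> chart_at A y"
abbreviation "H \<equiv> local_metric A g ch"
abbreviation "x \<equiv> snd ch y"

lemma ch: "ch \<in> A" "y \<in> fst ch"
proof -
  have "y \<in> (\<Union>d\<in>A. fst d)" using kahler y by (simp only: kahler_manifold_def complex_manifold_def)
  then have "\<exists>d. d \<in> A \<and> y \<in> fst d" by blast
  then have "ch \<in> A \<and> y \<in> fst ch" unfolding chart_at_def by (rule someI_ex)
  then show "ch \<in> A" "y \<in> fst ch" by auto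
qed

sublocale complex_manifold_point M A y ch
  using kahler ch by unfold_locales (auto simp: kahler_manifold_def)

sublocale kahler_domain "snd ch ` fst ch" H
proof
  have herm: "(\<forall>u v. smooth_on (\<lambda>x. H x u v) (snd ch ` fst ch)) \<and>
     (\<forall>x\<in>snd ch ` fst ch. bilinear (H x) \<and> (\<forall>u v. H x u v = H x v u) \<and> (\<forall>u. u \<noteq> 0 \<longrightarrow> H x u u > 0) \<and>
        (\<forall>u v. H x (\<i> *s u) (\<i> *s v) = H x u v))"
    using kahler ch(1) by (simp add: kahler_manifold_def hermitian_metric_def Let_def)
  show "open (snd ch ` fst ch)" using is_chart[OF ch(1)] by (simp add: is_chart_def)
  show "smooth_on (\<lambda>x. H x u v) (snd ch ` fst ch)" for u v using herm by blast
  show "bilinear (H p)" if "p \<in> snd ch ` fst ch" for p using herm that by blast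
  show "H p u v = H p v u" if "p \<in> snd ch ` fst ch" for p u v using herm that by blast
  show "H p u u > 0" if "p \<in> snd ch ` fst ch" "u \<noteq> 0" for p u using herm that by blast
  show "H p (\<i> *s u) (\<i> *s v) = H p u v" if "p \<in> snd ch ` fst ch" for p u v using herm that by blast
  have "kahler_form_closed A g" using kahler by (simp add: kahler_manifold_def)
  then have "\<forall>x\<in>snd ch ` fst ch. \<forall>u v w.
          frechet_derivative (\<lambda>p. H p (\<i> *s v) w) (at x) u +
          frechet_derivative (\<lambda>p. H p (\<i> *s w) u) (at x) v +
          frechet_derivative (\<lambda>p. H p (\<i> *s u) v) (at x) w = 0"
    unfolding kahler_form_closed_def Let_def using ch(1) by blast
  then show "frechet_derivative (\<lambda>p. H p (\<i> *s v) w) (at x) u +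
          frechet_derivative (\<lambda>p. H p (\<i> *s w) u) (at x) v +
          frechet_derivative (\<lambda>p. H p (\<i> *s u) v) (at x) w = 0"
    if "x \<in> snd ch ` fst ch" for x u v w using that by blast
qed

abbreviation "K \<equiv> \<lambda>X Y Z W. H x (local_curv H x X Y Z) W"

sublocale kc: kahler_curvature "H x" "\<lambda>v. \<i> *s v" K
  by (rule local_curv_kahler) (use ch in blast)

text \<open>Coordinates of the chosen basis, through which the traces over \<open>some_onb\<close>
  become traces over an orthonormal basis of the form \<open>H x\<close>.\<close>

definition frame :: "(complex^'m) set" where
  "frame = (\<lambda>X. X ch) ` some_onb A g y"

text \<open>An orthonormal basis of coordinate space lifts to the tangent space, so the choice in
  the definition has a witness.\<close>

lemma some_onb: "orthonormal_basis A g y (some_onb A g y)"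
proof -
  obtain B where B: "kc.orthonormal B" "card B = DIM(complex^'m)"
    using kc.orthonormal_exists by blast
  have "inj_on (tvec_of A ch y) B" by (rule inj_on_inverseI[where g = "\<lambda>X. X ch"]) (rule tvec_of_chart)
  then have "orthonormal_basis A g y (tvec_of A ch y ` B)"
    using B by (auto simp: orthonormal_basis_def tvec_of_in card_image local_metric_point[where g = g]
        tvec_of_chart kc.orthonormal_def dest: inj_onD)
  then show ?thesis unfolding some_onb_def by (rule someI)
qed

lemma inj_on_some_onb: "inj_on (\<lambda>X. X ch) (some_onb A g y)"
  using some_onb tangent_eqI by (auto simp: orthonormal_basis_def inj_on_def subset_iff)

lemma frame: "kc.orthonormal frame" "card frame = DIM(complex^'m)"
proof -
  have "g y X Y = H x (X ch) (Y ch)" if "X \<in> some_onb A g y" "Y \<in> some_onb A g y" for X Y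
    using some_onb that by (intro local_metric_point) (auto simp: orthonormal_basis_def)
  then show "kc.orthonormal frame"
    using some_onb inj_on_some_onb by (auto simp: kc.orthonormal_def frame_def orthonormal_basis_def dest: inj_onD)
  show "card frame = DIM(complex^'m)"
    using some_onb inj_on_some_onb by (simp add: frame_def card_image orthonormal_basis_def)
qed

lemma curv_eq: "curv A g y X Y Z W = K (X ch) (Y ch) (Z ch) (W ch)"
  by (simp add: curv_def Let_def)

lemma ricci_eq: "ricci A g y X Y = kc.ric frame (X ch) (Y ch)"
  unfolding ricci_def kc.ric_def frame_def curv_eq sum.reindex[OF inj_on_some_onb] by simp

lemma scalar_curvature_eq: "scalar_curvature A g y = (\<Sum>e\<in>frame. kc.ric frame e e)"
  unfolding scalar_curvature_def ricci_eq by (simp add: frame_def sum.reindex[OF inj_on_some_onb])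

text \<open>The real and imaginary parts of Z = u - \<surd>-1 C u contribute equally to its squared
  length, which is therefore \<open>2 * H x u u\<close>.\<close>

lemma T10_sphere_eq: "T10_sphere A g y = T10_of ` {u. H x u u = 1 / 2}"
proof -
  have "cext2 (g y) (T10_of u) (ctvec_cnj (T10_of u)) = complex_of_real (2 * H x u u)" for u
    unfolding ctvec_cnj_T10_of unfolding T10_of_def cext2_pair local_metric_point[OF tvec_of_in tvec_of_in, of g]
      tvec_of_chart by (simp add: kc.h_simps kc.h_J kc.sym)
  then show ?thesis
    unfolding T10_sphere_def T10_space_eq
    by (auto simp: complex_eq_iff image_iff)
qed

lemma ric_perp_T10_of: "ric_perp A g y (T10_of u) = 2 * kc.ric frame u u - 4 * K u (\<i> *s u) (\<i> *s u) u"
proof -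
  let ?j = "\<i> *s u"
  \<comment> \<open>Of the eight terms in the real part, the four with parallel vectors in an
    antisymmetric pair vanish; the other four are all equal to \<open>K u ?j ?j u\<close>.\<close>
  have 0: "K a a b d = 0" "K b d a a = 0" for a b d
    using kc.K_swap12[of a a b d] kc.K_swap34[of b d a a] by linarith+
  have s: "K ?j u ?j u = - K u ?j ?j u" "K ?j u u ?j = K u ?j ?j u" "K u ?j u ?j = - K u ?j ?j u"
    using kc.K_swap12[of ?j u ?j u] kc.K_swap12[of ?j u u ?j] kc.K_swap34[of u ?j u ?j] by linarith+
  have "Re (cext2 (ricci A g y) (T10_of u) (ctvec_cnj (T10_of u))) = 2 * kc.ric frame u u"
    unfolding ctvec_cnj_T10_of unfolding T10_of_def cext2_pair ricci_eq tvec_of_chart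
    by (simp add: linear_neg[OF kc.ric_linear(1)] kc.ric_J[OF frame])
  moreover have "Re (cext4 (curv A g y) (T10_of u) (ctvec_cnj (T10_of u)) (T10_of u) (ctvec_cnj (T10_of u)))
     = 4 * K u ?j ?j u"
    unfolding ctvec_cnj_T10_of unfolding T10_of_def Re_cext4_pair curv_eq tvec_of_chart kc.K_neg 0 s
    by simp
  ultimately show ?thesis by (simp add: ric_perp_def)
qed

lemma scalar_curvature_bound:
  assumes "CARD('m) \<ge> 2"
  shows "\<exists>Z\<^sub>0\<in>T10_sphere A g y. (\<forall>Z\<in>T10_sphere A g y. ric_perp A g y Z\<^sub>0 \<le> ric_perp A g y Z) \<and>
    scalar_curvature A g y \<ge>
      2 * real CARD('m) * (real CARD('m) + 1) / (real CARD('m) - 1) * ric_perp A g y Z\<^sub>0"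
proof -
  define m where "m = real CARD('m)"
  have m: "m > 1" using assms by (simp add: m_def)
  have dim: "real DIM(complex^'m) = 2 * m" by (simp add: m_def)
  obtain u where u: "H x u u = 1 / 2"
    "\<And>v. H x v v = 1 / 2 \<Longrightarrow> ric_perp A g y (T10_of u) \<le> ric_perp A g y (T10_of v)"
    "2 * m * (2 * m + 2) * ric_perp A g y (T10_of u) \<le> (2 * m - 2) * scalar_curvature A g y"
    using kc.scalar_lower_bound_attained[OF frame]
    unfolding ric_perp_T10_of scalar_curvature_eq dim by blast
  \<comment> \<open>With n = 2m, the factors n(n+2) = 4m(m+1) and n-2 = 2(m-1) have the stated
    quotient; m > 1 permits the division.\<close>
  have "2 * m * (m + 1) / (m - 1) * ric_perp A g y (T10_of u) \<le> scalar_curvature A g y"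
    using u(3) m by (simp add: field_simps)
  with u show ?thesis unfolding T10_sphere_eq m_def by blast
qed

end

theorem lemma1p1:
  fixes M :: "'a topology"
    and A :: "('a, 'm::finite) chart set"
    and g :: "('a, 'm) metric"
  assumes "kahler_manifold M A g"
    and "CARD('m) \<ge> 2"
  shows "((\<forall>y\<in>topspace M. \<forall>Z\<in>T10_sphere A g y. ric_perp A g y Z \<ge> 0) \<longrightarrow>
            (\<forall>y\<in>topspace M. scalar_curvature A g y \<ge> 0)) \<and>
         (\<forall>y\<in>topspace M. \<exists>Z\<^sub>0\<in>T10_sphere A g y.
            (\<forall>Z\<in>T10_sphere A g y. ric_perp A g y Z\<^sub>0 \<le> ric_perp A g y Z) \<and>
            scalar_curvature A g y \<ge>
              2 * real CARD('m) * (real CARD('m) + 1) / (real CARD('m) - 1) * ric_perp A g y Z\<^sub>0)"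
proof -
  have bound: "\<exists>Z\<^sub>0\<in>T10_sphere A g y. (\<forall>Z\<in>T10_sphere A g y. ric_perp A g y Z\<^sub>0 \<le> ric_perp A g y Z) \<and>
    scalar_curvature A g y \<ge>
      2 * real CARD('m) * (real CARD('m) + 1) / (real CARD('m) - 1) * ric_perp A g y Z\<^sub>0"
    if "y \<in> topspace M" for y
    by (rule kahler_manifold_point.scalar_curvature_bound[OF kahler_manifold_point.intro[OF assms(1) that] assms(2)])
  \<comment> \<open>The minimum is attained on the sphere, so it is one of the values assumed
    nonnegative, and its coefficient is nonnegative for m \<ge> 2.\<close>
  have "scalar_curvature A g y \<ge> 0"
    if nonneg: "\<forall>Z\<in>T10_sphere A g y. ric_perp A g y Z \<ge> 0" and "y \<in> topspace M" for y
  proof -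
    obtain Z\<^sub>0 where Z: "Z\<^sub>0 \<in> T10_sphere A g y" "scalar_curvature A g y \<ge>
      2 * real CARD('m) * (real CARD('m) + 1) / (real CARD('m) - 1) * ric_perp A g y Z\<^sub>0"
      using bound[OF \<open>y \<in> topspace M\<close>] by blast
    have "0 \<le> 2 * real CARD('m) * (real CARD('m) + 1) / (real CARD('m) - 1) * ric_perp A g y Z\<^sub>0"
      using nonneg Z(1) assms(2) by (intro mult_nonneg_nonneg divide_nonneg_nonneg) auto
    with Z(2) show ?thesis by linarith
  qed
  with bound show ?thesis by blast
qed

end
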